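(* Let $(A,\mathfrak a)$ be a unital good pair over $\Bbbk$ and let $n\ge 1$. The coproduct $\nabla$ on $\bigoplus_{d\ge0}M_n(A)^{\otimes d}$ restricts to coproducts on $$S^A(n):=\bigoplus_{d\ge0}S^A(n,d)\quad\text{and}\quad T^A_{\mathfrak a}(n):=\bigoplus_{d\ge0}T^A_{\mathfrak a}(n,d),$$ that is, $\nabla(S^A(n))\subseteq S^A(n)\otimes S^A(n)$ and $\nabla(T^A_{\mathfrak a}(n))\subseteq T^A_{\mathfrak a}(n)\otimes T^A_{\mathfrak a}(n)$.
   Context: $\Bbbk$ is a commutative domain of characteristic $0$. Superalgebras are $\mathbb Z/2$-graded associative (not necessarily unital) $\Bbbk$-algebras $A=A_{\bar 0}\oplus A_{\bar 1}$; $\bar a$ denotes the parity of a homogeneous element $a$; tensor products of superalgebras carry the product $(x\otimes y)(z\otimes w)=(-1)^{\bar y\bar z}xz\otimes yw$. A good pair $(A,\mathfrak a)$ consists of a superalgebra $A$ with $A_{\bar 0},A_{\bar 1}$ free over $\Bbbk$ and a subalgebra $\mathfrak a\subseteq A_{\bar 0}$ such that $\mathfrak a$ and $A/\mathfrak a$ are free $\Bbbk$-modules; it is a unital good pair if $A$ and $\mathfrak a$ are unital with $1_{\mathfrak a}=1_A$. An $(A,\mathfrak a)$-basis is a $\Bbbk$-basis $B=B_{\mathfrak a}\sqcup B_{\mathfrak c}\sqcup B_{\bar 1}$ of $A$, where $B_{\mathfrak a}$, $B_{\mathfrak c}$, $B_{\bar 1}$ are bases of $\mathfrak a$, of a chosen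 $\Bbbk$-module complement $\mathfrak c$ of $\mathfrak a$ in $A_{\bar 0}$, and of $A_{\bar 1}$, respectively; one such basis is fixed. For $a\in A$ put $\xi^a_{r,s}:=aE_{r,s}\in M_n(A)$ ($E_{r,s}$ the matrix units; $M_n(A)$ is a superalgebra via parities of entries). Write $[1,n]=\{1,\dots,n\}$. The symmetric group $\mathfrak S_d$ acts on the right on words by $(x_1\cdots x_d)\sigma=x_{\sigma 1}\cdots x_{\sigma d}$, diagonally on tuples of words, and on $M_n(A)^{\otimes d}$ by superalgebra automorphisms $(\xi^{a_1}_{r_1,s_1}\otimes\cdots\otimes\xi^{a_d}_{r_d,s_d})^\sigma=(-1)^{\langle\sigma;\boldsymbol a\rangle}\xi^{a_{\sigma1}}_{r_{\sigma1},s_{\sigma1}}\otimes\cdots\otimes\xi^{a_{\sigma d}}_{r_{\sigma d},s_{\sigma d}}$ for homogeneous $a_i$, where $\langle\sigma;\boldsymbol a\rangle=\#\{(k,l): k<l,\ \sigma^{-1}k>\sigma^{-1}l,\ a_k,a_l \text{ odd}\}$. Define $S^A(n,d):=(M_n(A)^{\otimes d})^{\mathfrak S_d}$. $\mathrm{Tri}^B(n,d)$ is the set of triples $(\boldsymbol b,\boldsymbol r,\boldsymbol s)\in B^d\times[1,n]^d\times[1,n]^d$ such that for $k\ne l$ the equality $(b_k,r_k,s_k)=(b_l,r_l,s_l)$ holds only if $b_k$ is even. For such a triple let $\xi^{\boldsymbol b}_{\boldsymbol r,\boldsymbol s}:=\sum_\sigma(\xi^{b_1}_{r_1,s_1}\otimes\cdots\otimes\xi^{b_d}_{r_d,s_d})^\sigma\in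 S^A(n,d)$, with $\sigma$ over representatives of the cosets $\mathfrak S_{\boldsymbol b,\boldsymbol r,\boldsymbol s}\backslash\mathfrak S_d$, where $\mathfrak S_{\boldsymbol b,\boldsymbol r,\boldsymbol s}$ is the stabilizer of the triple. Let $[\boldsymbol b,\boldsymbol r,\boldsymbol s]^b_{r,s}:=\#\{k: (b_k,r_k,s_k)=(b,r,s)\}$, $[\boldsymbol b,\boldsymbol r,\boldsymbol s]^!_{\mathfrak c}:=\prod_{b\in B_{\mathfrak c},\,r,s\in[1,n]}[\boldsymbol b,\boldsymbol r,\boldsymbol s]^b_{r,s}!$, and $\eta^{\boldsymbol b}_{\boldsymbol r,\boldsymbol s}:=[\boldsymbol b,\boldsymbol r,\boldsymbol s]^!_{\mathfrak c}\,\xi^{\boldsymbol b}_{\boldsymbol r,\boldsymbol s}$. Finally $T^A_{\mathfrak a}(n,d)$ is the $\Bbbk$-span of all $\eta^{\boldsymbol b}_{\boldsymbol r,\boldsymbol s}$ with $(\boldsymbol b,\boldsymbol r,\boldsymbol s)\in\mathrm{Tri}^B(n,d)$. The coproduct $\nabla$ is the (deconcatenation) map $M_n(A)^{\otimes d}\to\bigoplus_{l=0}^dM_n(A)^{\otimes l}\otimes M_n(A)^{\otimes(d-l)}$, $\xi_1\otimes\cdots\otimes\xi_d\mapsto\sum_{l=0}^d(\xi_1\otimes\cdots\otimes\xi_l)\otimes(\xi_{l+1}\otimes\cdots\otimes\xi_d)$. *)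

theory Defs
  imports
    "HOL-Analysis.Finite_Cartesian_Product"
    "HOL-Library.Poly_Mapping"
    "HOL-Library.Set_Algebras"
    "HOL-Combinatorics.Permutations"
begin

section \<open>Superalgebras and good pairs\<close>

text \<open>The superalgebra is the whole type \<open>'a\<close>, which is only a (not necessarily unital) ring;
  the scalar action is the parameter \<open>smul\<close>.\<close>

locale superalgebra = module smul
  for smul :: "'k::comm_ring_1 \<Rightarrow> 'a::ring \<Rightarrow> 'a" +
  fixes A0 A1 :: "'a set"
  assumes scale_mult_left: "smul c (x * y) = smul c x * y"
    and scale_mult_right: "smul c (x * y) = x * smul c y"
    and subspace_even: "subspace A0"
    and subspace_odd: "subspace A1"
    and even_odd_Int: "A0 \<inter> A1 = {0}"
    and even_odd_sum: "\<exists>y\<in>A0. \<exists>z\<in>A1. x = y + z"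
    and even_even: "x \<in> A0 \<Longrightarrow> y \<in> A0 \<Longrightarrow> x * y \<in> A0"
    and even_odd: "x \<in> A0 \<Longrightarrow> y \<in> A1 \<Longrightarrow> x * y \<in> A1"
    and odd_even: "x \<in> A1 \<Longrightarrow> y \<in> A0 \<Longrightarrow> x * y \<in> A1"
    and odd_odd: "x \<in> A1 \<Longrightarrow> y \<in> A1 \<Longrightarrow> x * y \<in> A0"

definition basis_of :: "('k::comm_ring_1 \<Rightarrow> 'a::ab_group_add \<Rightarrow> 'a) \<Rightarrow> 'a set \<Rightarrow> 'a set \<Rightarrow> bool" where
  "basis_of smul B V \<longleftrightarrow> \<not> module.dependent smul B \<and> module.span smul B = V"

definition free_submodule :: "('k::comm_ring_1 \<Rightarrow> 'a::ab_group_add \<Rightarrow> 'a) \<Rightarrow> 'a set \<Rightarrow> bool" where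
  "free_submodule smul V \<longleftrightarrow> (\<exists>B. basis_of smul B V)"

text \<open>Freeness of the quotient of the whole module by \<open>W\<close>; \<open>C\<close> is a set of representatives of a
  basis of the quotient.\<close>

definition free_quotient :: "('k::comm_ring_1 \<Rightarrow> 'a::ab_group_add \<Rightarrow> 'a) \<Rightarrow> 'a set \<Rightarrow> bool" where
  "free_quotient smul W \<longleftrightarrow>
     (\<exists>C. (\<forall>t u. finite t \<longrightarrow> t \<subseteq> C \<longrightarrow> (\<Sum>v\<in>t. smul (u v) v) \<in> W \<longrightarrow> (\<forall>v\<in>t. u v = 0))
        \<and> module.span smul (C \<union> W) = UNIV)"

locale good_pair = superalgebra smul A0 A1
  for smul :: "'k::comm_ring_1 \<Rightarrow> 'a::ring \<Rightarrow> 'a" and A0 A1 :: "'a set" +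
  fixes \<aa> :: "'a set"
  assumes free_even: "free_submodule smul A0"
    and free_odd: "free_submodule smul A1"
    and sub_even: "\<aa> \<subseteq> A0"
    and sub_subspace: "subspace \<aa>"
    and sub_mult: "x \<in> \<aa> \<Longrightarrow> y \<in> \<aa> \<Longrightarrow> x * y \<in> \<aa>"
    and free_sub: "free_submodule smul \<aa>"
    and free_quot: "free_quotient smul \<aa>"

locale unital_good_pair = good_pair +
  assumes unit: "\<exists>e\<in>\<aa>. \<forall>x. e * x = x \<and> x * e = x"

locale good_pair_basis = good_pair smul A0 A1 \<aa>
  for smul :: "'k::comm_ring_1 \<Rightarrow> 'a::ring \<Rightarrow> 'a" and A0 A1 \<aa> :: "'a set" +
  fixes \<cc> Ba Bc B1 :: "'a set"
  assumes compl_subspace: "subspace \<cc>"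
    and compl_sub: "\<cc> \<subseteq> A0"
    and compl_Int: "\<aa> \<inter> \<cc> = {0}"
    and compl_sum: "x \<in> A0 \<Longrightarrow> \<exists>y\<in>\<aa>. \<exists>z\<in>\<cc>. x = y + z"
    and basis_sub: "basis_of smul Ba \<aa>"
    and basis_compl: "basis_of smul Bc \<cc>"
    and basis_odd: "basis_of smul B1 A1"


section \<open>Free modules of formal sums\<close>

text \<open>\<open>'x \<Rightarrow>\<^sub>0 'k\<close> is the free \<open>'k\<close>-module on the type \<open>'x\<close>.\<close>

definition fscale :: "'k::comm_ring_1 \<Rightarrow> ('x \<Rightarrow>\<^sub>0 'k) \<Rightarrow> ('x \<Rightarrow>\<^sub>0 'k)" where
  "fscale c x = Poly_Mapping.map ((*) c) x"

lemma lookup_fscale [simp]: "Poly_Mapping.lookup (fscale c x) w = c * Poly_Mapping.lookup x w"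
  unfolding fscale_def by (transfer) (auto simp: when_def)

interpretation fmod: module "fscale :: 'k::comm_ring_1 \<Rightarrow> ('x \<Rightarrow>\<^sub>0 'k) \<Rightarrow> _"
  by unfold_locales (auto intro!: poly_mapping_eqI simp: lookup_add algebra_simps)

definition lin_ext :: "('x \<Rightarrow> ('y \<Rightarrow>\<^sub>0 'k)) \<Rightarrow> ('x \<Rightarrow>\<^sub>0 'k::comm_ring_1) \<Rightarrow> ('y \<Rightarrow>\<^sub>0 'k)" where
  "lin_ext f x = (\<Sum>w\<in>Poly_Mapping.keys x. fscale (Poly_Mapping.lookup x w) (f w))"

lemma fscale_single [simp]: "fscale c (Poly_Mapping.single w a) = Poly_Mapping.single w (c * a)"
  by (rule poly_mapping_eqI) (simp add: lookup_single when_def)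

lemma lin_ext_superset:
  assumes "finite S" "Poly_Mapping.keys x \<subseteq> S"
  shows "lin_ext f x = (\<Sum>w\<in>S. fscale (Poly_Mapping.lookup x w) (f w))"
  unfolding lin_ext_def using assms
  by (intro sum.mono_neutral_left) (auto simp: in_keys_iff)

lemma lin_ext_single [simp]: "lin_ext f (Poly_Mapping.single w c) = fscale c (f w)"
  by (subst lin_ext_superset[of "{w}"]) auto

lemma lin_ext_add: "lin_ext f (x + y) = lin_ext f x + lin_ext f y"
  by (subst (1 2 3) lin_ext_superset[of "Poly_Mapping.keys x \<union> Poly_Mapping.keys y"])
     (use keys_add[of x y] in \<open>auto simp: lookup_add fmod.scale_left_distrib sum.distrib\<close>)

lemma lin_ext_fscale: "lin_ext f (fscale c x) = fscale c (lin_ext f x)"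
  by (subst (1 2) lin_ext_superset[of "Poly_Mapping.keys x"])
     (auto simp: in_keys_iff fmod.scale_sum_right)

lemma lin_ext_hom: "module_hom fscale fscale (lin_ext f)"
  by unfold_locales (auto simp: lin_ext_add lin_ext_fscale fmod.scale_right_distrib
      fmod.scale_left_distrib)

text \<open>An element of the quotient of \<open>'x \<Rightarrow>\<^sub>0 'k\<close> by a submodule \<open>R\<close> is a coset \<open>x +o R\<close>.
  \<open>quot_span R X\<close> is the submodule of the quotient spanned by a set \<open>X\<close> of such cosets (the image
  of the span of all their representatives), and \<open>quot_map R' f\<close> is the map between
  quotients induced by \<open>f\<close>.\<close>

definition quot_span :: "('x \<Rightarrow>\<^sub>0 'k::comm_ring_1) set \<Rightarrow> ('x \<Rightarrow>\<^sub>0 'k) set set \<Rightarrow> ('x \<Rightarrow>\<^sub>0 'k) set set" where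
  "quot_span R X = (\<lambda>x. x +o R) ` fmod.span (\<Union>X)"

definition quot_map :: "('y \<Rightarrow>\<^sub>0 'k) set \<Rightarrow> (('x \<Rightarrow>\<^sub>0 'k) \<Rightarrow> ('y \<Rightarrow>\<^sub>0 'k)) \<Rightarrow>
    ('x \<Rightarrow>\<^sub>0 'k::comm_ring_1) set \<Rightarrow> ('y \<Rightarrow>\<^sub>0 'k) set" where
  "quot_map R' f X = (\<Union>x\<in>X. f x +o R')"

lemma mem_coset_iff: "y \<in> x +o R \<longleftrightarrow> y - x \<in> R" for x y :: "'a::ab_group_add"
  by (force simp: elt_set_plus_def)

lemma coset_eqI:
  assumes "fmod.subspace R" "x - y \<in> R"
  shows "x +o R = y +o R"
proof (intro set_eqI iffI)
  fix z
  show "z \<in> y +o R" if "z \<in> x +o R"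
    using that fmod.subspace_add[OF assms(1), of "z - x" "x - y"] assms(2)
    by (simp add: mem_coset_iff)
  show "z \<in> x +o R" if "z \<in> y +o R"
    using that fmod.subspace_diff[OF assms(1), of "z - y" "x - y"] assms(2)
    by (simp add: mem_coset_iff)
qed

lemma quot_map_coset:
  assumes "\<And>x. x \<in> G \<Longrightarrow> lin_ext f x \<in> R'" "fmod.subspace R'"
  shows "quot_map R' (lin_ext f) (x +o fmod.span G) = lin_ext f x +o R'"
proof -
  interpret module_hom fscale fscale "lin_ext f" by (rule lin_ext_hom)
  have *: "lin_ext f z \<in> R'" if "z \<in> fmod.span G" for z
    using that by (induction rule: fmod.span_induct)
      (use assms in \<open>auto simp: fmod.subspace_def add scale\<close>)
  have eq: "lin_ext f y +o R' = lin_ext f x +o R'" if "y \<in> x +o fmod.span G" for y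
    using that *[of "y - x"] by (intro coset_eqI assms(2)) (simp add: mem_coset_iff diff)
  have "x \<in> x +o fmod.span G" by (simp add: mem_coset_iff fmod.span_zero)
  with eq show ?thesis unfolding quot_map_def by blast
qed


section \<open>The tensor algebra and its coproduct\<close>

text \<open>The tensor algebra (as a module) of the module \<open>'m\<close> with scalar action \<open>s\<close> is the free
  module on the words over \<open>'m\<close> modulo the submodule \<open>tensor_ker s\<close> spanned by the
  multilinearity relations; \<open>x\<^sub>1 \<otimes> \<dots> \<otimes> x\<^sub>d\<close> is the coset of the word \<open>[x\<^sub>1, \<dots>, x\<^sub>d]\<close>.\<close>

definition word :: "'x \<Rightarrow> ('x \<Rightarrow>\<^sub>0 'k::comm_ring_1)" where
  "word w = Poly_Mapping.single w 1"

definition tensor_rels :: "('k::comm_ring_1 \<Rightarrow> 'm::ab_group_add \<Rightarrow> 'm) \<Rightarrow> ('m list \<Rightarrow>\<^sub>0 'k) set" where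
  "tensor_rels s =
     {word (u @ [x + y] @ v) - word (u @ [x] @ v) - word (u @ [y] @ v) | u v x y. True} \<union>
     {word (u @ [s c x] @ v) - fscale c (word (u @ [x] @ v)) | u v c x. True}"

definition tensor_ker :: "('k::comm_ring_1 \<Rightarrow> 'm::ab_group_add \<Rightarrow> 'm) \<Rightarrow> ('m list \<Rightarrow>\<^sub>0 'k) set" where
  "tensor_ker s = fmod.span (tensor_rels s)"

definition tensor_power :: "('k::comm_ring_1 \<Rightarrow> 'm::ab_group_add \<Rightarrow> 'm) \<Rightarrow> nat \<Rightarrow>
    ('m list \<Rightarrow>\<^sub>0 'k) set set" where
  "tensor_power s d =
     (\<lambda>x. x +o tensor_ker s) ` {x. \<forall>w\<in>Poly_Mapping.keys x. length w = d}"

text \<open>For \<open>F = ('m list \<Rightarrow>\<^sub>0 'k)\<close> and \<open>R = tensor_ker s\<close>, the tensor square of \<open>F / R\<close> is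
  realised as \<open>(F \<otimes> F) / (R \<otimes> F + F \<otimes> R)\<close>, where \<open>F \<otimes> F\<close> is the free module on pairs of
  words.  Its components are \<open>M\<^sup>\<otimes>\<^sup>l \<otimes> M\<^sup>\<otimes>\<^sup>m\<close>.\<close>

definition outer :: "('x \<Rightarrow>\<^sub>0 'k::comm_ring_1) \<Rightarrow> ('y \<Rightarrow>\<^sub>0 'k) \<Rightarrow> ('x \<times> 'y \<Rightarrow>\<^sub>0 'k)" where
  "outer x y = (\<Sum>u\<in>Poly_Mapping.keys x. \<Sum>v\<in>Poly_Mapping.keys y.
     Poly_Mapping.single (u, v) (Poly_Mapping.lookup x u * Poly_Mapping.lookup y v))"

definition tensor2_ker :: "('k::comm_ring_1 \<Rightarrow> 'm::ab_group_add \<Rightarrow> 'm) \<Rightarrow>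
    ('m list \<times> 'm list \<Rightarrow>\<^sub>0 'k) set" where
  "tensor2_ker s = fmod.span ({outer x y | x y. x \<in> tensor_ker s} \<union> {outer x y | x y. y \<in> tensor_ker s})"

text \<open>The submodule of the tensor square spanned by the \<open>X \<otimes> Y\<close> with \<open>X \<in> U\<close> and \<open>Y \<in> V\<close>.\<close>

definition tensor_sub :: "('k::comm_ring_1 \<Rightarrow> 'm::ab_group_add \<Rightarrow> 'm) \<Rightarrow>
    ('m list \<Rightarrow>\<^sub>0 'k) set set \<Rightarrow> ('m list \<Rightarrow>\<^sub>0 'k) set set \<Rightarrow>
    ('m list \<times> 'm list \<Rightarrow>\<^sub>0 'k) set set" where
  "tensor_sub s U V = quot_span (tensor2_ker s)
     {outer x y +o tensor2_ker s | x y. x +o tensor_ker s \<in> U \<and> y +o tensor_ker s \<in> V}"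

definition deconcat :: "'m list \<Rightarrow> ('m list \<times> 'm list \<Rightarrow>\<^sub>0 'k::comm_ring_1)" where
  "deconcat w = (\<Sum>l\<le>length w. word (take l w, drop l w))"

definition coproduct :: "('k::comm_ring_1 \<Rightarrow> 'm::ab_group_add \<Rightarrow> 'm) \<Rightarrow>
    ('m list \<Rightarrow>\<^sub>0 'k) set \<Rightarrow> ('m list \<times> 'm list \<Rightarrow>\<^sub>0 'k) set" where
  "coproduct s = quot_map (tensor2_ker s) (lin_ext deconcat)"


section \<open>Matrices over a superalgebra and the action of the symmetric group\<close>

definition mat_scale :: "('k \<Rightarrow> 'a \<Rightarrow> 'a) \<Rightarrow> 'k \<Rightarrow> 'a^'n^'n \<Rightarrow> 'a^'n^'n" where
  "mat_scale smul c X = (\<chi> i j. smul c (X $ i $ j))"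

definition mat_elem :: "'a::zero \<Rightarrow> 'n \<Rightarrow> 'n \<Rightarrow> 'a^'n^'n" where
  "mat_elem a r s = (\<chi> i j. if i = r \<and> j = s then a else 0)"

text \<open>The component of \<open>a\<close> in \<open>A1\<close> (if \<open>p\<close>) or in \<open>A0\<close> (if \<open>\<not> p\<close>).\<close>

definition part :: "'a::ab_group_add set \<Rightarrow> 'a set \<Rightarrow> bool \<Rightarrow> 'a \<Rightarrow> 'a" where
  "part A0 A1 p a = (THE x. x \<in> (if p then A1 else A0) \<and> a - x \<in> (if p then A0 else A1))"

definition mat_part :: "'a::ab_group_add set \<Rightarrow> 'a set \<Rightarrow> bool \<Rightarrow> 'a^'n^'n \<Rightarrow> 'a^'n^'n" where
  "mat_part A0 A1 p X = (\<chi> i j. part A0 A1 p (X $ i $ j))"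

text \<open>The number of inversions among odd letters; positions are counted from 0, and \<open>p\<close> is the
  list of parities (\<open>True\<close> for odd) of the letters.\<close>

definition odd_inversions :: "(nat \<Rightarrow> nat) \<Rightarrow> bool list \<Rightarrow> nat" where
  "odd_inversions \<sigma> p =
     card {(k, l). k < l \<and> l < length p \<and> inv \<sigma> k > inv \<sigma> l \<and> p ! k \<and> p ! l}"

text \<open>The action of \<open>\<sigma>\<close> on \<open>X\<^sub>1 \<otimes> \<dots> \<otimes> X\<^sub>d\<close>: each \<open>X\<^sub>k\<close> is split into its even and odd
  part, which gives \<open>2\<^sup>d\<close> terms with homogeneous letters.  Words of
  another length are sent to 0, so that this is well defined modulo \<open>tensor_ker\<close> on the whole
  tensor algebra.\<close>

definition perm_word :: "'a::ab_group_add set \<Rightarrow> 'a set \<Rightarrow> nat \<Rightarrow> (nat \<Rightarrow> nat) \<Rightarrow>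
    ('a^'n^'n) list \<Rightarrow> (('a^'n^'n) list \<Rightarrow>\<^sub>0 'k::comm_ring_1)" where
  "perm_word A0 A1 d \<sigma> w =
     (if length w = d
      then \<Sum>p | length p = d. fscale ((-1) ^ odd_inversions \<sigma> p)
             (word (map (\<lambda>k. mat_part A0 A1 (p ! \<sigma> k) (w ! \<sigma> k)) [0..<d]))
      else 0)"

definition perm_action :: "('k::comm_ring_1 \<Rightarrow> 'a::ab_group_add \<Rightarrow> 'a) \<Rightarrow> 'a set \<Rightarrow> 'a set \<Rightarrow>
    nat \<Rightarrow> (nat \<Rightarrow> nat) \<Rightarrow> (('a^'n^'n) list \<Rightarrow>\<^sub>0 'k) set \<Rightarrow> (('a^'n^'n) list \<Rightarrow>\<^sub>0 'k) set" where
  "perm_action smul A0 A1 d \<sigma> =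
     quot_map (tensor_ker (mat_scale smul)) (lin_ext (perm_word A0 A1 d \<sigma>))"


section \<open>The algebras \<open>S\<close> and \<open>T\<close>\<close>

definition S_alg_deg :: "('k::comm_ring_1 \<Rightarrow> 'a::ab_group_add \<Rightarrow> 'a) \<Rightarrow> 'a set \<Rightarrow> 'a set \<Rightarrow>
    nat \<Rightarrow> (('a^'n^'n) list \<Rightarrow>\<^sub>0 'k) set set" where
  "S_alg_deg smul A0 A1 d =
     {X \<in> tensor_power (mat_scale smul) d.
        \<forall>\<sigma>. \<sigma> permutes {..<d} \<longrightarrow> perm_action smul A0 A1 d \<sigma> X = X}"

text \<open>A triple of words \<open>(\<^bold>b, \<^bold>r, \<^bold>s)\<close> of length \<open>d\<close> is encoded as a word of \<open>d\<close> triples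
  \<open>(b\<^sub>k, r\<^sub>k, s\<^sub>k)\<close>; the index set \<open>[1,n]\<close> is the finite type \<open>'n\<close>.\<close>

definition Tri :: "'a set \<Rightarrow> 'a set \<Rightarrow> nat \<Rightarrow> ('a \<times> 'n \<times> 'n) list set" where
  "Tri A0 B d = {w. length w = d \<and> fst ` set w \<subseteq> B \<and>
     (\<forall>k<d. \<forall>l<d. k \<noteq> l \<longrightarrow> w ! k = w ! l \<longrightarrow> fst (w ! k) \<in> A0)}"

definition perm_list :: "(nat \<Rightarrow> nat) \<Rightarrow> 'x list \<Rightarrow> 'x list" where
  "perm_list \<sigma> w = map (\<lambda>k. w ! \<sigma> k) [0..<length w]"

definition stabilizer :: "'x list \<Rightarrow> (nat \<Rightarrow> nat) set" where
  "stabilizer w = {\<sigma>. \<sigma> permutes {..<length w} \<and> perm_list \<sigma> w = w}"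

definition stabilizer_cosets :: "'x list \<Rightarrow> (nat \<Rightarrow> nat) set set" where
  "stabilizer_cosets w =
     (\<lambda>\<sigma>. (\<lambda>\<tau>. \<tau> \<circ> \<sigma>) ` stabilizer w) ` {\<sigma>. \<sigma> permutes {..<length w}}"

definition xi_rep :: "'a::ab_group_add set \<Rightarrow> 'a set \<Rightarrow> ('a \<times> 'n \<times> 'n) list \<Rightarrow>
    (('a^'n^'n) list \<Rightarrow>\<^sub>0 'k::comm_ring_1)" where
  "xi_rep A0 A1 w = (\<Sum>C\<in>stabilizer_cosets w.
     perm_word A0 A1 (length w) (SOME \<sigma>. \<sigma> \<in> C) (map (\<lambda>(b, r, s). mat_elem b r s) w))"

text \<open>The product of \<open>[\<^bold>b, \<^bold>r, \<^bold>s]\<^sup>b\<^sub>r\<^sub>,\<^sub>s!\<close> over all \<open>b \<in> Bc\<close> and all \<open>r, s\<close>, restricted to the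
  finitely many factors with \<open>(b, r, s)\<close> occurring in the word: the others are \<open>0! = 1\<close>, while
  a product over an infinite set would be 1 by convention.\<close>

definition c_factorial :: "'a set \<Rightarrow> ('a \<times> 'n \<times> 'n) list \<Rightarrow> nat" where
  "c_factorial Bc w = (\<Prod>t | t \<in> set w \<and> fst t \<in> Bc. fact (count_list w t))"

definition eta :: "('k::comm_ring_1 \<Rightarrow> 'a::ab_group_add \<Rightarrow> 'a) \<Rightarrow> 'a set \<Rightarrow> 'a set \<Rightarrow> 'a set \<Rightarrow>
    ('a \<times> 'n \<times> 'n) list \<Rightarrow> (('a^'n^'n) list \<Rightarrow>\<^sub>0 'k) set" where
  "eta smul A0 A1 Bc w =
     fscale (of_nat (c_factorial Bc w)) (xi_rep A0 A1 w) +o tensor_ker (mat_scale smul)"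

definition T_alg_deg :: "('k::comm_ring_1 \<Rightarrow> 'a::ab_group_add \<Rightarrow> 'a) \<Rightarrow> 'a set \<Rightarrow> 'a set \<Rightarrow>
    'a set \<Rightarrow> 'a set \<Rightarrow> 'a set \<Rightarrow> nat \<Rightarrow> (('a^'n^'n) list \<Rightarrow>\<^sub>0 'k) set set" where
  "T_alg_deg smul A0 A1 Ba Bc B1 d = quot_span (tensor_ker (mat_scale smul))
     (eta smul A0 A1 Bc ` Tri A0 (Ba \<union> Bc \<union> B1) d)"

text \<open>The direct sums over \<open>d\<close> are internal sums in the tensor algebra, which is graded by the
  length of words.\<close>

definition S_alg :: "('k::comm_ring_1 \<Rightarrow> 'a::ab_group_add \<Rightarrow> 'a) \<Rightarrow> 'a set \<Rightarrow> 'a set \<Rightarrow>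
    (('a^'n^'n) list \<Rightarrow>\<^sub>0 'k) set set" where
  "S_alg smul A0 A1 = quot_span (tensor_ker (mat_scale smul)) (\<Union>d. S_alg_deg smul A0 A1 d)"

definition T_alg :: "('k::comm_ring_1 \<Rightarrow> 'a::ab_group_add \<Rightarrow> 'a) \<Rightarrow> 'a set \<Rightarrow> 'a set \<Rightarrow>
    'a set \<Rightarrow> 'a set \<Rightarrow> 'a set \<Rightarrow> (('a^'n^'n) list \<Rightarrow>\<^sub>0 'k) set set" where
  "T_alg smul A0 A1 Ba Bc B1 =
     quot_span (tensor_ker (mat_scale smul)) (\<Union>d. T_alg_deg smul A0 A1 Ba Bc B1 d)"


section \<open>Well-definedness\<close>

lemma outer_superset:
  assumes "finite S" "Poly_Mapping.keys x \<subseteq> S" "finite T" "Poly_Mapping.keys y \<subseteq> T"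
  shows "outer x y = (\<Sum>u\<in>S. \<Sum>v\<in>T.
     Poly_Mapping.single (u, v) (Poly_Mapping.lookup x u * Poly_Mapping.lookup y v))"
proof -
  have "outer x y = (\<Sum>u\<in>S. \<Sum>v\<in>Poly_Mapping.keys y.
     Poly_Mapping.single (u, v) (Poly_Mapping.lookup x u * Poly_Mapping.lookup y v))"
    unfolding outer_def using assms by (intro sum.mono_neutral_left) (auto simp: in_keys_iff)
  also have "\<dots> = (\<Sum>u\<in>S. \<Sum>v\<in>T.
     Poly_Mapping.single (u, v) (Poly_Mapping.lookup x u * Poly_Mapping.lookup y v))"
    using assms by (intro sum.cong refl sum.mono_neutral_left) (auto simp: in_keys_iff)
  finally show ?thesis .
qed

lemma lookup_outer [simp]:
  "Poly_Mapping.lookup (outer x y) (u, v) = Poly_Mapping.lookup x u * Poly_Mapping.lookup y v"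
proof -
  have "outer x y = (\<Sum>a\<in>insert u (Poly_Mapping.keys x). \<Sum>b\<in>insert v (Poly_Mapping.keys y).
     Poly_Mapping.single (a, b) (Poly_Mapping.lookup x a * Poly_Mapping.lookup y b))"
    by (rule outer_superset) auto
  also have "Poly_Mapping.lookup \<dots> (u, v) =
    (\<Sum>a\<in>insert u (Poly_Mapping.keys x). \<Sum>b\<in>insert v (Poly_Mapping.keys y).
      if b = v then if a = u then Poly_Mapping.lookup x u * Poly_Mapping.lookup y v else 0 else 0)"
    unfolding lookup_sum by (intro sum.cong refl) (auto simp: lookup_single when_def)
  also have "\<dots> = Poly_Mapping.lookup x u * Poly_Mapping.lookup y v"
    by (subst sum.delta, simp, simp)
  finally show ?thesis .
qed

lemma lookup_word: "Poly_Mapping.lookup (word w) v = (if w = v then 1 else 0)"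
  by (simp add: word_def lookup_single when_def)

lemma outer_word: "outer (word u) (word v) = word (u, v)"
  by (rule poly_mapping_eqI) (auto simp: lookup_word split: if_splits)

lemma outer_diff_left: "outer (x - x') y = outer x y - outer x' y"
  by (rule poly_mapping_eqI) (auto simp: lookup_minus algebra_simps)

lemma outer_diff_right: "outer x (y - y') = outer x y - outer x y'"
  by (rule poly_mapping_eqI) (auto simp: lookup_minus algebra_simps)

lemma outer_fscale_left: "outer (fscale c x) y = fscale c (outer x y)"
  by (rule poly_mapping_eqI) (auto simp: algebra_simps)

lemma outer_fscale_right: "outer x (fscale c y) = fscale c (outer x y)"
  by (rule poly_mapping_eqI) (auto simp: algebra_simps)

lemma lin_ext_word [simp]: "lin_ext f (word w) = f w"
  by (simp add: word_def)

lemma lin_ext_diff: "lin_ext f (x - y) = lin_ext f x - lin_ext f y"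
  using lin_ext_add[of f "x - y" y] by (simp add: algebra_simps)

lemma tensor_ker_add:
  "word (u @ [x + y] @ v) - word (u @ [x] @ v) - word (u @ [y] @ v) \<in> tensor_ker s"
  unfolding tensor_ker_def by (rule fmod.span_base) (unfold tensor_rels_def, blast)

lemma tensor_ker_scale:
  "word (u @ [s c x] @ v) - fscale c (word (u @ [x] @ v)) \<in> tensor_ker s"
  unfolding tensor_ker_def by (rule fmod.span_base) (unfold tensor_rels_def, blast)

lemma subspace_tensor_ker: "fmod.subspace (tensor_ker s)"
  by (simp add: tensor_ker_def)

lemma subspace_tensor2_ker: "fmod.subspace (tensor2_ker s)"
  by (simp add: tensor2_ker_def)

lemma tensor2_ker_left: "x \<in> tensor_ker s \<Longrightarrow> outer x y \<in> tensor2_ker s"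
  unfolding tensor2_ker_def by (rule fmod.span_base) blast

lemma tensor2_ker_right: "y \<in> tensor_ker s \<Longrightarrow> outer x y \<in> tensor2_ker s"
  unfolding tensor2_ker_def by (rule fmod.span_base) blast

lemma deconcat_cut:
  "(\<exists>u' v'. \<forall>z. word (take l (u @ [z] @ v), drop l (u @ [z] @ v)) = outer (word (u' @ [z] @ v')) (word v''))
   \<or> (\<exists>u'' v'. \<forall>z. word (take l (u @ [z] @ v), drop l (u @ [z] @ v)) = outer (word u'') (word (u' @ [z] @ v')))"
  if "v'' = drop (l - Suc (length u)) v" "u' = drop l u"
proof (cases "l \<le> length u")
  case True
  then show ?thesis using that by (auto simp: outer_word)
next
  case False
  then obtain m where "l = Suc (length u + m)"
    by (metis less_iff_Suc_add not_le)
  then show ?thesis using that by (auto simp: outer_word)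
qed

lemma deconcat_rels:
  fixes z :: "'m::ab_group_add list \<Rightarrow>\<^sub>0 'k::comm_ring_1"
  assumes "z \<in> tensor_rels s"
  shows "lin_ext deconcat z \<in> tensor2_ker s"
proof -
  let ?c = "\<lambda>l w. word (take l w, drop l w) :: 'm list \<times> 'm list \<Rightarrow>\<^sub>0 'k"
  from assms consider
    (add) u v x y where "z = word (u @ [x + y] @ v) - word (u @ [x] @ v) - word (u @ [y] @ v)"
  | (scale) u v c x where "z = word (u @ [s c x] @ v) - fscale c (word (u @ [x] @ v))"
    unfolding tensor_rels_def by blast
  then show ?thesis
  proof cases
    case add
    have "?c l (u @ [x + y] @ v) - ?c l (u @ [x] @ v) - ?c l (u @ [y] @ v) \<in> tensor2_ker s" for l
      using deconcat_cut[OF refl refl, of l u v]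
    proof (elim disjE exE)
      fix u' v' assume *: "\<forall>z. ?c l (u @ [z] @ v) =
        outer (word (u' @ [z] @ v')) (word (drop (l - Suc (length u)) v))"
      show ?thesis unfolding *[rule_format] outer_diff_left[symmetric]
        by (intro tensor2_ker_left tensor_ker_add)
    next
      fix u'' v' assume *: "\<forall>z. ?c l (u @ [z] @ v) =
        outer (word u'') (word (drop l u @ [z] @ v'))"
      show ?thesis unfolding *[rule_format] outer_diff_right[symmetric]
        by (intro tensor2_ker_right tensor_ker_add)
    qed
    then have "(\<Sum>l\<le>Suc (length u + length v).
        ?c l (u @ [x + y] @ v) - ?c l (u @ [x] @ v) - ?c l (u @ [y] @ v)) \<in> tensor2_ker s"
      by (intro fmod.subspace_sum[OF subspace_tensor2_ker])
    then show ?thesis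
      unfolding add lin_ext_diff lin_ext_word deconcat_def by (simp add: sum_subtractf)
  next
    case scale
    have "?c l (u @ [s c x] @ v) - fscale c (?c l (u @ [x] @ v)) \<in> tensor2_ker s" for l
      using deconcat_cut[OF refl refl, of l u v]
    proof (elim disjE exE)
      fix u' v' assume *: "\<forall>z. ?c l (u @ [z] @ v) =
        outer (word (u' @ [z] @ v')) (word (drop (l - Suc (length u)) v))"
      show ?thesis unfolding *[rule_format] outer_fscale_left[symmetric] outer_diff_left[symmetric]
        by (intro tensor2_ker_left tensor_ker_scale)
    next
      fix u'' v' assume *: "\<forall>z. ?c l (u @ [z] @ v) =
        outer (word u'') (word (drop l u @ [z] @ v'))"
      show ?thesis unfolding *[rule_format] outer_fscale_right[symmetric] outer_diff_right[symmetric]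
        by (intro tensor2_ker_right tensor_ker_scale)
    qed
    then have "(\<Sum>l\<le>Suc (length u + length v).
        ?c l (u @ [s c x] @ v) - fscale c (?c l (u @ [x] @ v))) \<in> tensor2_ker s"
      by (intro fmod.subspace_sum[OF subspace_tensor2_ker])
    then show ?thesis
      unfolding scale lin_ext_diff lin_ext_word lin_ext_fscale deconcat_def
      by (simp add: sum_subtractf fmod.scale_sum_right fmod.scale_right_distrib)
  qed
qed

lemma coproduct_coset:
  "coproduct s (x +o tensor_ker s) = lin_ext deconcat x +o tensor2_ker s"
  unfolding coproduct_def tensor_ker_def
  by (rule quot_map_coset) (auto intro: deconcat_rels subspace_tensor2_ker)

context superalgebra
begin

lemma part_eqI:
  assumes "x \<in> (if p then A1 else A0)" "a - x \<in> (if p then A0 else A1)"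
  shows "part A0 A1 p a = x"
  unfolding part_def
proof (rule the_equality)
  fix y assume y: "y \<in> (if p then A1 else A0) \<and> a - y \<in> (if p then A0 else A1)"
  have "y - x = (a - x) - (a - y)" by simp
  then have "y - x \<in> (if p then A1 else A0)" "y - x \<in> (if p then A0 else A1)"
    using assms y subspace_diff[OF subspace_even, of y x] subspace_diff[OF subspace_odd, of y x]
      subspace_diff[OF subspace_even, of "a - x" "a - y"]
      subspace_diff[OF subspace_odd, of "a - x" "a - y"]
    by (simp_all split: if_splits)
  then have "y - x \<in> A0 \<inter> A1" by (auto split: if_splits)
  then show "y = x" using even_odd_Int by auto
qed (use assms in auto)

lemma part_mem: "part A0 A1 p a \<in> (if p then A1 else A0)" (is ?th1)
  and part_compl: "a - part A0 A1 p a \<in> (if p then A0 else A1)" (is ?th2)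
proof -
  obtain y z where yz: "y \<in> A0" "z \<in> A1" "a = y + z" using even_odd_sum by blast
  then have "part A0 A1 p a = (if p then z else y)" by (intro part_eqI) auto
  with yz show ?th1 ?th2 by auto
qed

lemma part_add: "part A0 A1 p (a + b) = part A0 A1 p a + part A0 A1 p b"
proof (rule part_eqI)
  have "(a + b) - (part A0 A1 p a + part A0 A1 p b) =
    (a - part A0 A1 p a) + (b - part A0 A1 p b)" by simp
  moreover have "(a - part A0 A1 p a) + (b - part A0 A1 p b) \<in> (if p then A0 else A1)"
    using part_compl[of a p] part_compl[of b p] subspace_add[OF subspace_even]
      subspace_add[OF subspace_odd] by (metis (full_types))
  ultimately show "(a + b) - (part A0 A1 p a + part A0 A1 p b) \<in> (if p then A0 else A1)"
    by (simp only:)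
qed (use part_mem[of p a] part_mem[of p b] subspace_add[OF subspace_even]
      subspace_add[OF subspace_odd] in \<open>auto split: if_splits\<close>)

lemma part_scale: "part A0 A1 p (smul c a) = smul c (part A0 A1 p a)"
  by (rule part_eqI)
     (use part_mem[of p a] part_compl[of a p] subspace_scale[OF subspace_even]
      subspace_scale[OF subspace_odd] in
      \<open>auto split: if_splits simp: scale_right_diff_distrib[symmetric]\<close>)

lemma part_homogeneous:
  assumes "a \<in> (if q then A1 else A0)"
  shows "part A0 A1 p a = (if p = q then a else 0)"
  by (rule part_eqI)
     (use assms subspace_0[OF subspace_even] subspace_0[OF subspace_odd] in
      \<open>auto split: if_splits\<close>)

lemma mat_part_add: "mat_part A0 A1 p (X + Y) = mat_part A0 A1 p X + mat_part A0 A1 p Y"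
  by (simp add: mat_part_def vec_eq_iff part_add)

lemma mat_part_scale:
  "mat_part A0 A1 p (mat_scale smul c X) = mat_scale smul c (mat_part A0 A1 p X)"
  by (simp add: mat_part_def mat_scale_def vec_eq_iff part_scale)

lemma mat_part_homogeneous:
  assumes "a \<in> (if q then A1 else A0)"
  shows "mat_part A0 A1 p (mat_elem a r s) = (if p = q then mat_elem a r s else 0)"
  using part_homogeneous[OF assms, of p] part_homogeneous[of 0 p p]
    subspace_0[OF subspace_even] subspace_0[OF subspace_odd]
  by (auto simp: mat_part_def mat_elem_def vec_eq_iff)

lemma word_zero_letter:
  fixes w :: "('a^'n^'n) list"
  assumes "0 \<in> set w"
  shows "word w \<in> tensor_ker (mat_scale smul)"
proof -
  obtain u v where w: "w = u @ [0] @ v" using split_list[OF assms] by auto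
  have "mat_scale smul 0 (0 :: 'a^'n^'n) = 0" by (simp add: mat_scale_def vec_eq_iff)
  with tensor_ker_scale[of u "mat_scale smul" 0 "0 :: 'a^'n^'n" v] show ?thesis by (simp add: w)
qed

lemma perm_word_slot:
  assumes "\<sigma> permutes {..<d}" "Suc (length u + length v) = d"
  shows "\<exists>u' v'. \<forall>z. map (\<lambda>k. mat_part A0 A1 (p ! \<sigma> k) ((u @ [z] @ v) ! \<sigma> k)) [0..<d] =
      u' @ [mat_part A0 A1 (p ! length u) z] @ v'"
proof -
  define j where "j = inv \<sigma> (length u)"
  have sj: "\<sigma> j = length u" unfolding j_def using assms(1) by (simp add: permutes_inverses)
  have jd: "j < d" using assms permutes_in_image[OF assms(1), of j] sj by simp
  have split: "[0..<d] = [0..<j] @ [j] @ [Suc j..<d]"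
    using jd upt_add_eq_append[of 0 j "d - j"] by (simp add: upt_conv_Cons)
  let ?f = "\<lambda>z k. mat_part A0 A1 (p ! \<sigma> k) ((u @ [z] @ v) ! \<sigma> k)"
  have ne: "?f z k = ?f undefined k" if "k \<noteq> j" for z k
  proof -
    have "\<sigma> k \<noteq> length u" using that sj permutes_inj[OF assms(1)] by (metis injD)
    then show ?thesis by (auto simp: nth_append nth_Cons split: nat.splits)
  qed
  have "map (?f z) [0..<d] = map (?f undefined) [0..<j] @ [mat_part A0 A1 (p ! length u) z] @
      map (?f undefined) [Suc j..<d]" for z
    unfolding split map_append using ne[of _ z] sj by auto
  then show ?thesis by blast
qed

lemma perm_word_rels:
  fixes z :: "('a^'n^'n) list \<Rightarrow>\<^sub>0 'k"
  assumes "\<sigma> permutes {..<d}" "z \<in> tensor_rels (mat_scale smul)"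
  shows "lin_ext (perm_word A0 A1 d \<sigma>) z \<in> tensor_ker (mat_scale smul)"
proof -
  let ?W = "\<lambda>p w. word (map (\<lambda>k. mat_part A0 A1 (p ! \<sigma> k) (w ! \<sigma> k)) [0..<d])
    :: ('a^'n^'n) list \<Rightarrow>\<^sub>0 'k"
  let ?sg = "\<lambda>p. (-1) ^ odd_inversions \<sigma> p :: 'k"
  have zero: "0 \<in> tensor_ker (mat_scale smul)" using fmod.subspace_0[OF subspace_tensor_ker] .
  from assms(2) consider
    (add) u v x y where "z = word (u @ [x + y] @ v) - word (u @ [x] @ v) - word (u @ [y] @ v)"
  | (scale) u v c x where
      "z = word (u @ [mat_scale smul c x] @ v) - fscale c (word (u @ [x] @ v))"
    unfolding tensor_rels_def by blast
  then show ?thesis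
  proof cases
    case add
    show ?thesis
    proof (cases "Suc (length u + length v) = d")
      case True
      have "fscale (?sg p) (?W p (u @ [x + y] @ v) - ?W p (u @ [x] @ v) - ?W p (u @ [y] @ v))
          \<in> tensor_ker (mat_scale smul)" for p
      proof -
        from perm_word_slot[OF assms(1) True, of p] obtain u' v' where
          *: "\<And>z. map (\<lambda>k. mat_part A0 A1 (p ! \<sigma> k) ((u @ [z] @ v) ! \<sigma> k)) [0..<d] =
            u' @ [mat_part A0 A1 (p ! length u) z] @ v'" by blast
        show ?thesis unfolding * mat_part_add
          by (intro fmod.subspace_scale[OF subspace_tensor_ker] tensor_ker_add)
      qed
      then have "(\<Sum>p | length p = d.
          fscale (?sg p) (?W p (u @ [x + y] @ v) - ?W p (u @ [x] @ v) - ?W p (u @ [y] @ v)))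
          \<in> tensor_ker (mat_scale smul)"
        by (intro fmod.subspace_sum[OF subspace_tensor_ker])
      then show ?thesis unfolding add lin_ext_diff lin_ext_word perm_word_def using True
        by (simp add: sum_subtractf fmod.scale_right_diff_distrib)
    qed (use zero in \<open>simp add: add lin_ext_diff perm_word_def\<close>)
  next
    case scale
    show ?thesis
    proof (cases "Suc (length u + length v) = d")
      case True
      have "fscale (?sg p) (?W p (u @ [mat_scale smul c x] @ v) - fscale c (?W p (u @ [x] @ v)))
          \<in> tensor_ker (mat_scale smul)" for p
      proof -
        from perm_word_slot[OF assms(1) True, of p] obtain u' v' where
          *: "\<And>z. map (\<lambda>k. mat_part A0 A1 (p ! \<sigma> k) ((u @ [z] @ v) ! \<sigma> k)) [0..<d] =
            u' @ [mat_part A0 A1 (p ! length u) z] @ v'" by blast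
        show ?thesis unfolding * mat_part_scale
          by (intro fmod.subspace_scale[OF subspace_tensor_ker] tensor_ker_scale)
      qed
      then have "(\<Sum>p | length p = d.
          fscale (?sg p) (?W p (u @ [mat_scale smul c x] @ v) - fscale c (?W p (u @ [x] @ v))))
          \<in> tensor_ker (mat_scale smul)"
        by (intro fmod.subspace_sum[OF subspace_tensor_ker])
      then show ?thesis
        unfolding scale lin_ext_diff lin_ext_fscale lin_ext_word perm_word_def using True
        by (simp add: sum_subtractf fmod.scale_right_diff_distrib fmod.scale_sum_right mult.commute)
    qed (use zero in \<open>simp add: scale lin_ext_diff lin_ext_fscale perm_word_def\<close>)
  qed
qed

lemma perm_action_coset:
  assumes "\<sigma> permutes {..<d}"
  shows "perm_action smul A0 A1 d \<sigma> (x +o tensor_ker (mat_scale smul)) =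
    lin_ext (perm_word A0 A1 d \<sigma>) x +o tensor_ker (mat_scale smul)"
  unfolding perm_action_def tensor_ker_def
  by (rule quot_map_coset) (use perm_word_rels[OF assms] in \<open>auto simp: tensor_ker_def\<close>)

text \<open>The action on tensor products of \<open>a\<^sub>k E\<^bsub>r\<^sub>k,s\<^sub>k\<^esub>\<close> with \<open>a\<^sub>k\<close> homogeneous of parity
  \<open>p\<^sub>k\<close>.\<close>

lemma perm_action_mat_elem:
  fixes a :: "nat \<Rightarrow> 'a" and r s :: "nat \<Rightarrow> 'n::finite"
  assumes \<sigma>: "\<sigma> permutes {..<d}" and p: "length p = d"
    and a: "\<And>k. k < d \<Longrightarrow> a k \<in> (if p ! k then A1 else A0)"
  shows "perm_action smul A0 A1 d \<sigma>
      (word (map (\<lambda>k. mat_elem (a k) (r k) (s k)) [0..<d]) +o tensor_ker (mat_scale smul)) =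
    fscale ((-1) ^ odd_inversions \<sigma> p)
      (word (map (\<lambda>k. mat_elem (a (\<sigma> k)) (r (\<sigma> k)) (s (\<sigma> k))) [0..<d]))
      +o tensor_ker (mat_scale smul)"
proof -
  let ?w = "map (\<lambda>k. mat_elem (a k) (r k) (s k)) [0..<d]"
  let ?t = "\<lambda>q. fscale ((-1) ^ odd_inversions \<sigma> q)
    (word (map (\<lambda>k. mat_part A0 A1 (q ! \<sigma> k) (?w ! \<sigma> k)) [0..<d])) :: ('a^'n^'n) list \<Rightarrow>\<^sub>0 'k"
  have lt: "\<sigma> k < d" if "k < d" for k using permutes_in_image[OF \<sigma>, of k] that by simp
  have letter: "mat_part A0 A1 (q ! k) (?w ! k) = (if q ! k = p ! k then ?w ! k else 0)"
    if "k < d" for q k using mat_part_homogeneous[OF a[OF that], of "q ! k" "r k" "s k"] that by simp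
  have fin: "finite {q :: bool list. length q = d}"
    using finite_lists_length_eq[of "UNIV :: bool set" d] by simp
  have "?t q \<in> tensor_ker (mat_scale smul)" if q: "length q = d" "q \<noteq> p" for q
  proof -
    obtain j where j: "j < d" "q ! j \<noteq> p ! j" using q p by (auto simp: list_eq_iff_nth_eq)
    have "\<sigma> (inv \<sigma> j) = j" using \<sigma> by (simp add: permutes_inverses)
    moreover have "inv \<sigma> j < d"
      using permutes_in_image[OF permutes_inv[OF \<sigma>], of j] j by simp
    ultimately have "0 \<in> set (map (\<lambda>k. mat_part A0 A1 (q ! \<sigma> k) (?w ! \<sigma> k)) [0..<d])"
      using letter[OF j(1), of q] j(2) by (auto simp: image_iff intro!: bexI[of _ "inv \<sigma> j"])
    then show ?thesis
      by (intro fmod.subspace_scale[OF subspace_tensor_ker] word_zero_letter)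
  qed
  then have "(\<Sum>q\<in>{q. length q = d} - {p}. ?t q) \<in> tensor_ker (mat_scale smul)"
    by (intro fmod.subspace_sum[OF subspace_tensor_ker]) auto
  moreover have "perm_word A0 A1 d \<sigma> ?w = ?t p + (\<Sum>q\<in>{q. length q = d} - {p}. ?t q)"
    unfolding perm_word_def using p sum.remove[OF fin, of p ?t] by simp
  ultimately have "perm_word A0 A1 d \<sigma> ?w +o tensor_ker (mat_scale smul) =
      ?t p +o tensor_ker (mat_scale smul)"
    by (intro coset_eqI[OF subspace_tensor_ker]) simp
  moreover have "map (\<lambda>k. mat_part A0 A1 (p ! \<sigma> k) (?w ! \<sigma> k)) [0..<d] =
      map (\<lambda>k. mat_elem (a (\<sigma> k)) (r (\<sigma> k)) (s (\<sigma> k))) [0..<d]"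
    using letter lt by auto
  ultimately show ?thesis by (simp add: perm_action_coset[OF \<sigma>])
qed

end

end

(* In a basis of matrix units b E_{r,s}, an element of the tensor power of M_n(A) is a finitely
   supported function y on words of triples (b, r, s).  It lies in S^A(n,d) iff y is symmetric up to
   the sign of the odd letters (such a y vanishes on words with a repeated odd letter because 2 is
   not a zero divisor), and in T^A(n,d) iff moreover y(w) is divisible by the factorial c!(w) of the
   multiplicities in w of the letters from the complement.

   The component of the coproduct of y in degrees (l, d - l) is the function (u, v) |-> y(uv).  By
   symmetry in u it is the sum, over representatives u0 of the orbits of words of length l, of
   xi_{u0}(u) y(u0 v), that is of (c!(u0) xi_{u0}) tensor (y(u0 -) / c!(u0)).  The second factor is
   again symmetric, and since c!(u0) c!(v) divides c!(u0 v) its value at v is divisible by c!(v). *)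
theory Submission
  imports Defs
begin

section \<open>Signs of rearrangements\<close>

text \<open>The tensor algebra is a quotient, so it has to be shown that a tensor has well-defined
  coefficients: \<open>expand\<close> reads off coordinates in words of matrix units,
  \<open>assemble\<close> goes back, and since \<open>expand\<close> kills the relations, invariance
  modulo \<open>tensor_ker\<close> becomes an identity between coefficients. The obstacle is the
  signs. The permutation carrying one word to another is not unique, and the sign with which u
  occurs for u0 has to match that with which uv occurs for u0 v. \<open>word_sign\<close> makes no
  choice, and on words without repeated odd letters it is compatible with cutting. If u0 and v share
  an odd letter, the prefix sign need not vanish, but then y does. The tensor factors are treated
  unequally because of the division: the weight of the prefix moves to the first factor, and the
  second is a quotient. That the quotient inherits support and symmetry from y is seen by
  multiplying with c!(u0), a nonzero element of a domain of characteristic 0. Weight 1 gives S and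
  weight c! gives T, so one computation serves both.\<close>

lemma perm_list_eq_permute_list: "perm_list = permute_list"
  by (intro ext) (simp add: perm_list_def permute_list_def)

definition index_pairs :: "nat \<Rightarrow> (nat \<times> nat) set" where
  "index_pairs n = {(i, j). i < j \<and> j < n}"

lemma finite_index_pairs [simp]: "finite (index_pairs n)"
  by (rule finite_subset[of _ "{..<n} \<times> {..<n}"]) (auto simp: index_pairs_def)

text \<open>A permutation of positions permutes the unordered pairs. \<open>srt \<sigma>\<close> is
  this map on pairs written in increasing order, with inverse \<open>srt (inv \<sigma>)\<close>; the
  symmetry of \<open>g\<close> absorbs the sorting.\<close>

lemma prod_index_pairs_permutes:
  fixes g :: "nat \<Rightarrow> nat \<Rightarrow> 'b::comm_monoid_mult"
  assumes \<sigma>: "\<sigma> permutes {..<n}" and g: "\<And>i j. g i j = g j i"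
  shows "(\<Prod>(i, j)\<in>index_pairs n. g (\<sigma> i) (\<sigma> j)) = (\<Prod>(i, j)\<in>index_pairs n. g i j)"
proof -
  define srt :: "(nat \<Rightarrow> nat) \<Rightarrow> nat \<times> nat \<Rightarrow> nat \<times> nat" where
    "srt f = (\<lambda>(i, j). (min (f i) (f j), max (f i) (f j)))" for f
  have lt: "\<sigma> i < n" "inv \<sigma> i < n" if "i < n" for i
    using permutes_in_image[OF \<sigma>, of i] permutes_in_image[OF permutes_inv[OF \<sigma>], of i] that by simp_all
  have ne: "\<sigma> i \<noteq> \<sigma> j" "inv \<sigma> i \<noteq> inv \<sigma> j" if "i \<noteq> j" for i j
    using permutes_inj[OF \<sigma>] permutes_inj[OF permutes_inv[OF \<sigma>]] that by (meson injD)+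
  have maps: "srt f x \<in> index_pairs n" if x: "x \<in> index_pairs n" and f: "f = \<sigma> \<or> f = inv \<sigma>" for f x
  proof -
    obtain i j where x: "x = (i, j)" "i < j" "j < n" "i < n"
      using x unfolding index_pairs_def by fastforce
    then have "f i < n" "f j < n" "f i \<noteq> f j"
      using f lt ne[of i j] by auto
    then show ?thesis by (auto simp: x srt_def index_pairs_def min_def max_def)
  qed
  have inverse: "srt f (srt h x) = x" if "x \<in> index_pairs n" "\<And>i. f (h i) = i" for f h x
    using that by (cases x) (auto simp: srt_def index_pairs_def min_def max_def)
  show ?thesis
  proof (rule prod.reindex_bij_witness[where i = "srt (inv \<sigma>)" and j = "srt \<sigma>"])
    fix x assume x: "x \<in> index_pairs n"
    show "srt (inv \<sigma>) (srt \<sigma> x) = x" "srt \<sigma> (srt (inv \<sigma>) x) = x"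
      using x \<sigma> by (auto intro!: inverse simp: permutes_inverses)
    show "srt \<sigma> x \<in> index_pairs n" "srt (inv \<sigma>) x \<in> index_pairs n"
      using x maps by auto
    show "(case srt \<sigma> x of (i, j) \<Rightarrow> g i j) = (case x of (i, j) \<Rightarrow> g (\<sigma> i) (\<sigma> j))"
      using g by (cases x) (auto simp: srt_def min_def max_def)
  qed
qed

text \<open>With \<open>p\<close> meaning odd, the right-hand side is the condition on repeated
  letters in \<open>Tri\<close>. As distinctness of the odd letters it is visibly invariant under
  rearrangement and passes to parts of a word.\<close>

lemma distinct_filter_nth_iff:
  "distinct (filter p w) \<longleftrightarrow>
    (\<forall>k<length w. \<forall>l<length w. k \<noteq> l \<longrightarrow> w ! k = w ! l \<longrightarrow> \<not> p (w ! k))"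
proof (induction w)
  case (Cons t w)
  have "(\<forall>k<length (t # w). \<forall>l<length (t # w). k \<noteq> l \<longrightarrow>
        (t # w) ! k = (t # w) ! l \<longrightarrow> \<not> p ((t # w) ! k)) \<longleftrightarrow>
      (p t \<longrightarrow> t \<notin> set w) \<and> distinct (filter p w)"
    unfolding Cons.IH by (auto simp: All_less_Suc2 in_set_conv_nth)
  then show ?case by auto
qed simp

text \<open>Equal letters share an index, so that a repeated odd letter produces a factor
  \<open>sgn 0\<close> in \<open>word_sign\<close>. A letter that does not occur gets
  \<open>length w\<close>.\<close>

definition first_index :: "'x list \<Rightarrow> 'x \<Rightarrow> nat" where
  "first_index w t = length (takeWhile (\<lambda>x. x \<noteq> t) w)"

lemma first_index_less: "t \<in> set w \<Longrightarrow> first_index w t < length w"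
  by (induction w) (auto simp: first_index_def)

lemma nth_first_index: "t \<in> set w \<Longrightarrow> w ! first_index w t = t"
  by (induction w) (auto simp: first_index_def)

lemma first_index_append_left: "t \<in> set u \<Longrightarrow> first_index (u @ v) t = first_index u t"
  by (auto simp: first_index_def takeWhile_append)

lemma first_index_append_right: "t \<notin> set u \<Longrightarrow> first_index (u @ v) t = length u + first_index v t"
  by (auto simp: first_index_def takeWhile_append)

lemma first_index_nth:
  assumes "distinct (filter p w)" "k < length w" "p (w ! k)"
  shows "first_index w (w ! k) = k"
proof -
  have "w ! k \<in> set w" using assms by simp
  from nth_first_index[OF this] first_index_less[OF this] assms show ?thesis
    unfolding distinct_filter_nth_iff by metis
qed

text \<open>For a rearrangement \<open>u\<close> of a word \<open>w\<close> without repeated odd letters, this is the sign with which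
  \<open>u\<close> occurs in the orbit sum of \<open>w\<close>.  Since it is a product over unordered pairs of positions,
  no permutation carrying \<open>w\<close> to \<open>u\<close> has to be chosen, and the cocycle property of the sign of
  the action becomes the reindexing of a product.\<close>

definition word_sign :: "('x \<Rightarrow> bool) \<Rightarrow> 'x list \<Rightarrow> 'x list \<Rightarrow> int" where
  "word_sign p w u = (\<Prod>(i, j)\<in>index_pairs (length u).
     if p (u ! i) \<and> p (u ! j)
     then sgn (int (first_index w (u ! j)) - int (first_index w (u ! i))) else 1)"

text \<open>Brings the sign of the action into the pairwise form of \<open>word_sign\<close>. The
  factors are nonzero since \<open>inv \<sigma>\<close> is injective, and they are -1 exactly at the
  counted inversions.\<close>

lemma minus_one_power_odd_inversions:
  assumes \<sigma>: "\<sigma> permutes {..<length q}"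
  shows "(- 1 :: int) ^ odd_inversions \<sigma> q = (\<Prod>(k, l)\<in>index_pairs (length q).
    if q ! k \<and> q ! l then sgn (int (inv \<sigma> l) - int (inv \<sigma> k)) else 1)"
proof -
  let ?I = "{(k, l). k < l \<and> l < length q \<and> inv \<sigma> k > inv \<sigma> l \<and> q ! k \<and> q ! l}"
  have ne: "inv \<sigma> i \<noteq> inv \<sigma> j" if "i \<noteq> j" for i j
    using permutes_inj[OF permutes_inv[OF \<sigma>]] that by (meson injD)
  have sub: "?I \<subseteq> index_pairs (length q)" by (auto simp: index_pairs_def)
  have "(\<Prod>(k, l)\<in>index_pairs (length q).
      if q ! k \<and> q ! l then sgn (int (inv \<sigma> l) - int (inv \<sigma> k)) else 1) =
      (\<Prod>x\<in>index_pairs (length q). if x \<in> ?I then - 1 else 1)"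
  proof (intro prod.cong refl, clarify)
    fix k l assume "(k, l) \<in> index_pairs (length q)"
    then show "(if q ! k \<and> q ! l then sgn (int (inv \<sigma> l) - int (inv \<sigma> k)) else 1) =
        (if (k, l) \<in> ?I then - 1 else 1)"
      using ne[of k l] by (auto simp: index_pairs_def sgn_if)
  qed
  also have "\<dots> = (\<Prod>x\<in>?I. - 1)"
    using sub by (simp add: prod.If_cases Int_absorb1)
  finally show ?thesis by (simp add: odd_inversions_def)
qed

text \<open>The signs of \<open>\<sigma>\<close> and of \<open>u\<close> are both products of
  factors antisymmetric in the two positions, so the combined factor \<open>g\<close> is symmetric
  and may be reindexed by \<open>\<sigma>\<close>. This turns the factor from
  \<open>\<sigma>\<close> into \<open>sgn (j - i) = 1\<close>, and what is left is the sign of the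
  rearranged word.\<close>

lemma word_sign_perm_list:
  assumes \<sigma>: "\<sigma> permutes {..<length u}"
  shows "word_sign p w (perm_list \<sigma> u) =
    (- 1) ^ odd_inversions \<sigma> (map p u) * word_sign p w u"
proof -
  let ?s = "\<lambda>k l. sgn (int (inv \<sigma> l) - int (inv \<sigma> k))"
  let ?e = "\<lambda>k l. sgn (int (first_index w (u ! l)) - int (first_index w (u ! k)))"
  define g where "g k l = (if p (u ! k) \<and> p (u ! l) then ?s k l * ?e k l else 1)" for k l
  have "g k l = g l k" for k l
    by (auto simp: g_def sgn_if)
  then have "(\<Prod>(i, j)\<in>index_pairs (length u). g (\<sigma> i) (\<sigma> j)) = (\<Prod>(i, j)\<in>index_pairs (length u). g i j)"
    by (rule prod_index_pairs_permutes[OF \<sigma>])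
  moreover have "word_sign p w (perm_list \<sigma> u) = (\<Prod>(i, j)\<in>index_pairs (length u). g (\<sigma> i) (\<sigma> j))"
    unfolding word_sign_def
    by (intro prod.cong) (use \<sigma> in \<open>auto simp: perm_list_def g_def index_pairs_def permutes_inverses\<close>)
  moreover have "(\<Prod>(i, j)\<in>index_pairs (length u). g i j) =
      (- 1) ^ odd_inversions \<sigma> (map p u) * word_sign p w u"
    using \<sigma> unfolding word_sign_def
    by (subst minus_one_power_odd_inversions)
       (auto simp: prod.distrib[symmetric] g_def index_pairs_def intro!: prod.cong)
  ultimately show ?thesis by simp
qed

lemma word_sign_self:
  assumes "distinct (filter p w)"
  shows "word_sign p w w = 1"
  unfolding word_sign_def
  by (intro prod.neutral) (auto simp: index_pairs_def first_index_nth[OF assms])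

lemma word_sign_eq_0:
  assumes "\<not> distinct (filter p u)"
  shows "word_sign p w u = 0"
proof -
  from assms obtain k l where kl: "k < length u" "l < length u" "k \<noteq> l" "u ! k = u ! l" "p (u ! k)"
    unfolding distinct_filter_nth_iff by blast
  then have "(min k l, max k l) \<in> index_pairs (length u)"
    by (auto simp: index_pairs_def)
  with kl show ?thesis unfolding word_sign_def
    by (intro prod_zero bexI[of _ "(min k l, max k l)"]) (auto simp: min_def max_def)
qed

lemma distinct_filter_mset_cong:
  "mset u = mset w \<Longrightarrow> distinct (filter p u) \<longleftrightarrow> distinct (filter p w)"
  by (rule mset_eq_imp_distinct_iff) simp

text \<open>A permutation taking \<open>u\<close> to \<open>u'\<close> multiplies the sign by the
  same factor for every reference word, and for the reference word \<open>u\<close> that factor is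
  \<open>word_sign p u u'\<close>. A repeated odd letter makes both sides 0.\<close>

lemma word_sign_trans:
  assumes "mset u' = mset u"
  shows "word_sign p w u' = word_sign p u u' * word_sign p w u"
proof (cases "distinct (filter p u)")
  case True
  from assms obtain \<sigma> where "\<sigma> permutes {..<length u}" "perm_list \<sigma> u = u'"
    unfolding perm_list_eq_permute_list by (rule mset_eq_permutation)
  with word_sign_perm_list[of \<sigma> u p] word_sign_self[OF True] show ?thesis
    by auto
next
  case False
  then show ?thesis
    using distinct_filter_mset_cong[OF assms, of p] by (simp add: word_sign_eq_0)
qed

text \<open>Since the odd letters of \<open>u @ v\<close> are distinct, those of \<open>v\<close>
  have their own position as index and all odd letters in front of them have smaller ones; so pairs
  that end in \<open>v\<close> contribute 1. Pairs inside the prefix have the same indices as in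
  \<open>u\<close>.\<close>

lemma word_sign_append_left:
  assumes "mset u' = mset u" "distinct (filter p (u @ v))"
  shows "word_sign p (u @ v) (u' @ v) = word_sign p u u'"
proof -
  let ?e = "\<lambda>w x (i, j). if p (x ! i) \<and> p (x ! j)
    then sgn (int (first_index w (x ! j)) - int (first_index w (x ! i))) else 1"
  have len: "length u' = length u" and set: "set u' = set u"
    using assms(1) by (auto dest: mset_eq_length mset_eq_setD)
  have right: "first_index (u @ v) ((u' @ v) ! j) = j"
    if "length u \<le> j" "j < length u + length v" "p ((u' @ v) ! j)" for j
    using first_index_nth[OF assms(2), of j] that len by (simp add: nth_append)
  have left: "first_index (u @ v) (u' ! i) = first_index u (u' ! i)" "first_index u (u' ! i) < length u"
    if "i < length u" for i
    using that set len nth_mem[of i u'] by (simp_all add: first_index_append_left first_index_less)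
  have "(\<Prod>x\<in>index_pairs (length u + length v). ?e (u @ v) (u' @ v) x) =
      (\<Prod>x\<in>index_pairs (length u). ?e (u @ v) (u' @ v) x)"
  proof (rule prod.mono_neutral_right)
    show "\<forall>x\<in>index_pairs (length u + length v) - index_pairs (length u). ?e (u @ v) (u' @ v) x = 1"
    proof
      fix x assume x: "x \<in> index_pairs (length u + length v) - index_pairs (length u)"
      obtain i j where xij: "x = (i, j)" by (cases x)
      with x have ij: "i < j" "j < length u + length v" "length u \<le> j"
        by (auto simp: index_pairs_def)
      have "int (first_index (u @ v) ((u' @ v) ! i)) < int j" if "p ((u' @ v) ! i)"
      proof (cases "i < length u")
        case True
        then show ?thesis using left[OF True] ij len by (simp add: nth_append)
      next
        case False
        then show ?thesis using right[of i] that ij by simp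
      qed
      then show "?e (u @ v) (u' @ v) x = 1" using right[of j] ij xij by auto
    qed
  qed (simp, auto simp: index_pairs_def)
  also have "\<dots> = (\<Prod>x\<in>index_pairs (length u). ?e u u' x)"
    by (intro prod.cong refl) (auto simp: index_pairs_def nth_append len left)
  finally show ?thesis by (simp add: word_sign_def len)
qed

text \<open>Pairs that start in \<open>u\<close> contribute 1, and for pairs inside the suffix all
  indices are shifted by \<open>length u\<close>, which cancels in the differences. Distinctness
  ensures that no odd letter of \<open>v\<close> already occurs in \<open>u\<close>.\<close>

lemma word_sign_append_right:
  assumes "mset v' = mset v" "distinct (filter p (u @ v))"
  shows "word_sign p (u @ v) (u @ v') = word_sign p v v'"
proof -
  let ?e = "\<lambda>w x (i, j). if p (x ! i) \<and> p (x ! j)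
    then sgn (int (first_index w (x ! j)) - int (first_index w (x ! i))) else 1"
  let ?sh = "\<lambda>(i, j). (length u + i, length u + j)"
  have len: "length v' = length v" and set: "set v' = set v"
    using assms(1) by (auto dest: mset_eq_length mset_eq_setD)
  have left: "first_index (u @ v) (u ! j) = j" if "j < length u" "p (u ! j)" for j
    using first_index_nth[OF assms(2), of j] that by (simp add: nth_append)
  have right: "first_index (u @ v) (v' ! j) = length u + first_index v (v' ! j)"
    if "j < length v" "p (v' ! j)" for j
  proof (rule first_index_append_right)
    show "v' ! j \<notin> set u" using that set len assms(2) nth_mem[of j v'] by auto
  qed
  have "(\<Prod>x\<in>index_pairs (length u + length v). ?e (u @ v) (u @ v') x) =
      (\<Prod>x\<in>?sh ` index_pairs (length v). ?e (u @ v) (u @ v') x)"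
  proof (rule prod.mono_neutral_right)
    show "\<forall>x\<in>index_pairs (length u + length v) - ?sh ` index_pairs (length v).
        ?e (u @ v) (u @ v') x = 1"
    proof
      fix x assume x: "x \<in> index_pairs (length u + length v) - ?sh ` index_pairs (length v)"
      obtain i j where xij: "x = (i, j)" by (cases x)
      with x have *: "(i, j) \<in> index_pairs (length u + length v)"
        "(i, j) \<notin> ?sh ` index_pairs (length v)" by auto
      have i: "i < length u"
      proof (rule ccontr)
        assume "\<not> i < length u"
        with * have "(i - length u, j - length u) \<in> index_pairs (length v)"
          "(i, j) = ?sh (i - length u, j - length u)" by (auto simp: index_pairs_def)
        with *(2) show False by blast
      qed
      have "first_index (u @ v) ((u @ v') ! j) > i" if "p ((u @ v') ! j)"
      proof (cases "j < length u")
        case True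
        then show ?thesis using * that left[of j] by (simp add: nth_append index_pairs_def)
      next
        case False
        then show ?thesis using * i that right[of "j - length u"]
          by (simp add: nth_append index_pairs_def)
      qed
      then show "?e (u @ v) (u @ v') x = 1" using left[of i] i xij by (auto simp: nth_append)
    qed
  qed (simp, auto simp: index_pairs_def)
  also have "\<dots> = (\<Prod>x\<in>index_pairs (length v). ?e (u @ v) (u @ v') (?sh x))"
    by (rule prod.reindex_cong[of ?sh]) (auto simp: inj_on_def)
  also have "\<dots> = (\<Prod>x\<in>index_pairs (length v). ?e v v' x)"
    by (intro prod.cong refl) (auto simp: index_pairs_def nth_append right)
  finally show ?thesis by (simp add: word_sign_def len)
qed

text \<open>The inverted odd pairs are \<open>(a, b)\<close> and, for each odd position
  \<open>m\<close> strictly between, both \<open>(a, m)\<close> and \<open>(m, b)\<close>.\<close>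

lemma odd_odd_inversions_transpose:
  assumes ab: "a < b" "b < length q" "q ! a" "q ! b"
  shows "odd (odd_inversions (transpose a b) q)"
proof -
  let ?I = "{m. a < m \<and> m < b \<and> q ! m}"
  have fin: "finite ?I" by (rule finite_subset[of _ "{..<b}"]) auto
  have "{(k, l). k < l \<and> l < length q \<and> inv (transpose a b) k > inv (transpose a b) l \<and> q ! k \<and> q ! l}
      = insert (a, b) (Pair a ` ?I \<union> (\<lambda>m. (m, b)) ` ?I)"
    using ab by (auto simp: transpose_def split: if_splits)
  moreover have "card (Pair a ` ?I \<union> (\<lambda>m. (m, b)) ` ?I) = card ?I + card ?I"
    using fin by (subst card_Un_disjoint) (auto simp: card_image inj_on_def)
  moreover have "(a, b) \<notin> Pair a ` ?I \<union> (\<lambda>m. (m, b)) ` ?I" by auto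
  ultimately show ?thesis using fin by (simp add: odd_inversions_def)
qed

text \<open>Stated for rearrangements rather than permutations. The case \<open>u = w\<close> is not
  vacuous: it forces \<open>y\<close> to vanish on words with a repeated odd letter, where
  \<open>word_sign p w w = 0\<close>.\<close>

definition signed_symmetric :: "('x \<Rightarrow> bool) \<Rightarrow> ('x list \<Rightarrow>\<^sub>0 'k::comm_ring_1) \<Rightarrow> bool" where
  "signed_symmetric p y \<longleftrightarrow> (\<forall>w u. mset u = mset w \<longrightarrow>
     Poly_Mapping.lookup y u = of_int (word_sign p w u) * Poly_Mapping.lookup y w)"

lemma signed_symmetricD:
  assumes "signed_symmetric p y" "mset u = mset w"
  shows "Poly_Mapping.lookup y u = of_int (word_sign p w u) * Poly_Mapping.lookup y w"
  using assms unfolding signed_symmetric_def by blast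

lemma signed_symmetric_eq_0:
  assumes "signed_symmetric p y" "\<not> distinct (filter p w)"
  shows "Poly_Mapping.lookup y w = 0"
  using signed_symmetricD[OF assms(1) refl, of w] word_sign_eq_0[OF assms(2), of w] by simp

lemma signed_symmetric_perm_list:
  assumes y: "signed_symmetric p y" and \<sigma>: "\<sigma> permutes {..<length w}"
  shows "Poly_Mapping.lookup y (perm_list \<sigma> w) =
    (- 1) ^ odd_inversions \<sigma> (map p w) * Poly_Mapping.lookup y w"
proof -
  \<comment> \<open>The factor \<open>word_sign p w w\<close> may be 0; it is not cancelled but
    absorbed into the value of \<open>y\<close> at \<open>w\<close> by the case \<open>u = w\<close>
    of signed symmetry.\<close>
  have "Poly_Mapping.lookup y (perm_list \<sigma> w) =
      (- 1) ^ odd_inversions \<sigma> (map p w) * (of_int (word_sign p w w) * Poly_Mapping.lookup y w)"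
    using signed_symmetricD[OF y, of "perm_list \<sigma> w" w] \<sigma> word_sign_perm_list[OF \<sigma>, of p w]
    by (simp add: perm_list_eq_permute_list mult.assoc)
  with signed_symmetricD[OF y refl, of w] show ?thesis by simp
qed

lemma signed_symmetricI:
  fixes y :: "'x list \<Rightarrow>\<^sub>0 'k::{idom, ring_char_0}"
  assumes *: "\<And>w \<sigma>. \<sigma> permutes {..<length w} \<Longrightarrow> Poly_Mapping.lookup y (perm_list \<sigma> w) =
    (- 1) ^ odd_inversions \<sigma> (map p w) * Poly_Mapping.lookup y w"
  shows "signed_symmetric p y"
  unfolding signed_symmetric_def
proof (intro allI impI)
  fix w u :: "'x list" assume mset: "mset u = mset w"
  from mset obtain \<sigma> where \<sigma>: "\<sigma> permutes {..<length w}" "perm_list \<sigma> w = u"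
    unfolding perm_list_eq_permute_list by (rule mset_eq_permutation)
  show "Poly_Mapping.lookup y u = of_int (word_sign p w u) * Poly_Mapping.lookup y w"
  proof (cases "distinct (filter p w)")
    case True
    with * \<sigma> word_sign_perm_list[OF \<sigma>(1), of p w] word_sign_self[OF True] show ?thesis
      by auto
  next
    case False
    then obtain a b where ab: "a < b" "b < length w" "w ! a = w ! b" "p (w ! a)"
      unfolding distinct_filter_nth_iff by (metis linorder_neq_iff)
    \<comment> \<open>Exchanging the two equal odd letters fixes the word but has sign -1.\<close>
    have "transpose a b permutes {..<length w}"
      using ab by (intro permutes_swap_id) auto
    moreover have "perm_list (transpose a b) w = w"
      using ab by (auto simp: perm_list_def transpose_def intro!: nth_equalityI)
    moreover have "odd (odd_inversions (transpose a b) (map p w))"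
      using ab by (intro odd_odd_inversions_transpose) auto
    ultimately have "Poly_Mapping.lookup y w = - Poly_Mapping.lookup y w"
      using *[of "transpose a b" w] by simp
    then have "2 * Poly_Mapping.lookup y w = 0"
      by (metis mult_2 add.right_inverse)
    then have "Poly_Mapping.lookup y w = 0" by simp
    then show ?thesis using *[OF \<sigma>(1)] \<sigma>(2) by simp
  qed
qed

section \<open>Signed symmetric functions on words\<close>

lemma lookup_lin_ext:
  "Poly_Mapping.lookup (lin_ext f x) v =
    (\<Sum>w\<in>Poly_Mapping.keys x. Poly_Mapping.lookup x w * Poly_Mapping.lookup (f w) v)"
  by (simp add: lin_ext_def lookup_sum)

lemma lin_ext_zero [simp]: "lin_ext f 0 = 0"
  by (simp add: lin_ext_def)

lemma lin_ext_sum: "lin_ext f (sum g I) = (\<Sum>i\<in>I. lin_ext f (g i))"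
  by (induction I rule: infinite_finite_induct) (simp_all add: lin_ext_add)

lemma lin_ext_cong:
  "(\<And>w. w \<in> Poly_Mapping.keys x \<Longrightarrow> f w = g w) \<Longrightarrow> lin_ext f x = lin_ext g x"
  by (simp add: lin_ext_def)

lemma lin_ext_lin_ext: "lin_ext f (lin_ext g x) = lin_ext (\<lambda>w. lin_ext f (g w)) x"
  unfolding lin_ext_def[of g x] lin_ext_def[of "\<lambda>w. lin_ext f (g w)" x]
  by (simp add: lin_ext_sum lin_ext_fscale)

lemma lin_ext_word_id [simp]: "lin_ext word x = x"
  by (rule poly_mapping_eqI)
     (auto simp: lookup_lin_ext lookup_word in_keys_iff if_distrib cong: if_cong)

lemma lin_ext_sum_fun: "lin_ext (\<lambda>w. \<Sum>i\<in>I. f i w) x = (\<Sum>i\<in>I. lin_ext (f i) x)"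
  unfolding lin_ext_def by (subst sum.swap) (simp add: fmod.scale_sum_right)

lemma lin_ext_mem:
  assumes "fmod.subspace V" "\<And>w. w \<in> Poly_Mapping.keys x \<Longrightarrow> f w \<in> V"
  shows "lin_ext f x \<in> V"
  unfolding lin_ext_def using assms
  by (intro fmod.subspace_sum fmod.subspace_scale) auto

lemma lin_ext_diff_mem:
  assumes "fmod.subspace V" "\<And>w. w \<in> Poly_Mapping.keys x \<Longrightarrow> f w - g w \<in> V"
  shows "lin_ext f x - lin_ext g x \<in> V"
proof -
  have "lin_ext f x - lin_ext g x = lin_ext (\<lambda>w. f w - g w) x"
    by (simp add: lin_ext_def sum_subtractf fmod.scale_right_diff_distrib)
  with lin_ext_mem[OF assms] show ?thesis by simp
qed

text \<open>The coordinates of \<open>xi_rep\<close> for a word in \<open>Tri\<close>, summed over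
  the distinct rearrangements instead of the cosets of the stabilizer. With a repeated odd letter
  all coefficients are 0.\<close>

definition orbit_sum :: "('x \<Rightarrow> bool) \<Rightarrow> 'x list \<Rightarrow> ('x list \<Rightarrow>\<^sub>0 'k::comm_ring_1)" where
  "orbit_sum p w = (\<Sum>u | mset u = mset w. Poly_Mapping.single u (of_int (word_sign p w u)))"

lemma lookup_orbit_sum:
  "Poly_Mapping.lookup (orbit_sum p w) u = (if mset u = mset w then of_int (word_sign p w u) else 0)"
  using mset_eq_finite[of w]
  by (auto simp: orbit_sum_def lookup_sum lookup_single when_def)

lemma signed_symmetric_orbit_sum:
  fixes w :: "'x list"
  shows "signed_symmetric p (orbit_sum p w)"
  unfolding signed_symmetric_def
proof (intro allI impI)
  fix v u :: "'x list" assume mset: "mset u = mset v"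
  show "Poly_Mapping.lookup (orbit_sum p w) u =
      of_int (word_sign p v u) * Poly_Mapping.lookup (orbit_sum p w) v"
    by (simp add: lookup_orbit_sum mset word_sign_trans[OF mset, of p w])
qed

lemma signed_symmetric_fscale: "signed_symmetric p y \<Longrightarrow> signed_symmetric p (fscale c y)"
  using signed_symmetricD[of p y]
  by (subst signed_symmetric_def) (metis lookup_fscale mult.left_commute)

text \<open>The sign sees only the prefixes. If \<open>u\<close> and \<open>v\<close> share an odd
  letter, the prefix sign may be nonzero while that of the whole words is 0; then both values of
  \<open>y\<close> vanish.\<close>

lemma signed_symmetric_append_left:
  assumes y: "signed_symmetric p y" and mset: "mset u' = mset u"
  shows "Poly_Mapping.lookup y (u' @ v) = of_int (word_sign p u u') * Poly_Mapping.lookup y (u @ v)"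
proof (cases "distinct (filter p (u @ v))")
  case True
  have "mset (u' @ v) = mset (u @ v)" using mset by simp
  from signed_symmetricD[OF y this] word_sign_append_left[OF mset True] show ?thesis by simp
next
  case False
  moreover have "mset (u' @ v) = mset (u @ v)" using mset by simp
  then have "\<not> distinct (filter p (u' @ v))" using False distinct_filter_mset_cong by blast
  ultimately show ?thesis by (metis mult_zero_right signed_symmetric_eq_0[OF y])
qed

lemma signed_symmetric_append_right:
  assumes y: "signed_symmetric p y" and mset: "mset v' = mset v"
  shows "Poly_Mapping.lookup y (u @ v') = of_int (word_sign p v v') * Poly_Mapping.lookup y (u @ v)"
proof (cases "distinct (filter p (u @ v))")
  case True
  have "mset (u @ v') = mset (u @ v)" using mset by simp
  from signed_symmetricD[OF y this] word_sign_append_right[OF mset True] show ?thesis by simp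
next
  case False
  moreover have "mset (u @ v') = mset (u @ v)" using mset by simp
  then have "\<not> distinct (filter p (u @ v'))" using False distinct_filter_mset_cong by blast
  ultimately show ?thesis by (metis mult_zero_right signed_symmetric_eq_0[OF y])
qed

text \<open>Cutting the words of \<open>y\<close> after \<open>l\<close> letters: by symmetry in the first \<open>l\<close> letters, only one
  prefix \<open>u\<^sub>0\<close> from each orbit is needed, and \<open>u \<mapsto> y (u v)\<close> is a multiple of the orbit sum of
  \<open>u\<^sub>0\<close>.\<close>

lemma signed_symmetric_prefixes:
  fixes y :: "'x list \<Rightarrow>\<^sub>0 'k::comm_ring_1"
  assumes y: "signed_symmetric p y"
  obtains R where "finite R" "\<And>u\<^sub>0. u\<^sub>0 \<in> R \<Longrightarrow> length u\<^sub>0 = l"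
    "\<And>u\<^sub>0. u\<^sub>0 \<in> R \<Longrightarrow> \<exists>v. u\<^sub>0 @ v \<in> Poly_Mapping.keys y"
    "\<And>u v. length u = l \<Longrightarrow> Poly_Mapping.lookup y (u @ v) =
      (\<Sum>u\<^sub>0\<in>R. Poly_Mapping.lookup (orbit_sum p u\<^sub>0) u * Poly_Mapping.lookup y (u\<^sub>0 @ v))"
proof -
  \<comment> \<open>The choice depends only on the multiset of \<open>u\<close>, so each orbit has a
    single representative.\<close>
  define rep :: "'x list \<Rightarrow> 'x list" where "rep u = (SOME u'. mset u' = mset u)" for u
  have mset_rep: "mset (rep u) = mset u" for u
    unfolding rep_def by (rule someI[of _ u]) simp
  have rep_cong: "rep u = rep u'" if "mset u = mset u'" for u u'
    using that by (simp add: rep_def)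
  \<comment> \<open>Prefixes of keys suffice, which makes \<open>R\<close> finite; representatives
    of such prefixes are again prefixes of keys, and this controls their letters.\<close>
  define R where "R = (\<lambda>w. rep (take l w)) ` {w \<in> Poly_Mapping.keys y. l \<le> length w}"
  have rep_key: "rep u @ v \<in> Poly_Mapping.keys y" if "u @ v \<in> Poly_Mapping.keys y" for u v
    using signed_symmetric_append_left[OF y, of u "rep u" v] mset_rep[of u] that
    by (auto simp: in_keys_iff)
  show thesis
  proof
    show "finite R" by (simp add: R_def)
    show "length u\<^sub>0 = l" if "u\<^sub>0 \<in> R" for u\<^sub>0
    proof -
      from that obtain w where "l \<le> length w" "u\<^sub>0 = rep (take l w)" by (auto simp: R_def)
      then show ?thesis using mset_eq_length[OF mset_rep[of "take l w"]] by simp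
    qed
    show "\<exists>v. u\<^sub>0 @ v \<in> Poly_Mapping.keys y" if "u\<^sub>0 \<in> R" for u\<^sub>0
    proof -
      from that obtain w where "w \<in> Poly_Mapping.keys y" "u\<^sub>0 = rep (take l w)" by (auto simp: R_def)
      then show ?thesis using rep_key[of "take l w" "drop l w"] by auto
    qed
    fix u v :: "'x list" assume u: "length u = l"
    let ?t = "\<lambda>u\<^sub>0. Poly_Mapping.lookup (orbit_sum p u\<^sub>0) u * Poly_Mapping.lookup y (u\<^sub>0 @ v)"
    have "?t u\<^sub>0 = 0" if "u\<^sub>0 \<in> R - {rep u}" for u\<^sub>0
    proof -
      from that obtain w where w: "u\<^sub>0 = rep (take l w)" "u\<^sub>0 \<noteq> rep u" by (auto simp: R_def)
      with rep_cong mset_rep have "mset u \<noteq> mset u\<^sub>0" by metis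
      then show ?thesis by (simp add: lookup_orbit_sum)
    qed
    then have "sum ?t R = sum ?t (R \<inter> {rep u})"
      by (intro sum.mono_neutral_right) (auto simp: R_def)
    also have "\<dots> = Poly_Mapping.lookup y (u @ v)"
    proof (cases "rep u \<in> R")
      case True
      then show ?thesis
        using mset_rep[of u]
        by (simp add: lookup_orbit_sum signed_symmetric_append_left[OF y, of u "rep u" v])
    next
      case False
      then have "u @ v \<notin> Poly_Mapping.keys y" using u by (force simp: R_def)
      then show ?thesis using False by (simp add: in_keys_iff)
    qed
    finally show "Poly_Mapping.lookup y (u @ v) = sum ?t R" ..
  qed
qed

text \<open>Coordinates in degree \<open>d\<close> of \<open>S\<close> for the weight
  \<open>m = 1\<close> and of \<open>T\<close> for \<open>m = c_factorial Bc\<close>.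
  \<open>L\<close> confines the letters to indices of basis elements, since the type of letters is
  larger.\<close>

definition weighted_invariants ::
    "('x \<Rightarrow> bool) \<Rightarrow> ('x list \<Rightarrow> nat) \<Rightarrow> 'x set \<Rightarrow> nat \<Rightarrow> ('x list \<Rightarrow>\<^sub>0 'k::comm_ring_1) set" where
  "weighted_invariants p m L d = {y. signed_symmetric p y \<and>
     (\<forall>w\<in>Poly_Mapping.keys y. length w = d \<and> set w \<subseteq> L) \<and>
     (\<forall>w. of_nat (m w) dvd Poly_Mapping.lookup y w)}"

lemma orbit_sum_mem_weighted_invariants:
  assumes m: "\<And>u w. mset u = mset w \<Longrightarrow> m u = m w" and w: "length w = d" "set w \<subseteq> L"
  shows "fscale (of_nat (m w)) (orbit_sum p w) \<in> weighted_invariants p m L d"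
  unfolding weighted_invariants_def
proof (intro CollectI conjI ballI allI)
  fix u
  show "of_nat (m u) dvd Poly_Mapping.lookup (fscale (of_nat (m w)) (orbit_sum p w)) u"
    using m[of u w] by (simp add: lookup_orbit_sum)
  assume "u \<in> Poly_Mapping.keys (fscale (of_nat (m w)) (orbit_sum p w))"
  then have "mset u = mset w" by (rule contrapos_pp) (simp add: in_keys_iff lookup_orbit_sum)
  then show "length u = d" "set u \<subseteq> L"
    using w mset_eq_length[of u w] mset_eq_setD[of u w] by simp_all
qed (intro signed_symmetric_fscale signed_symmetric_orbit_sum)

text \<open>The decomposition by prefixes with \<open>l = d\<close> and empty suffix: the
  coefficient of the orbit sum of \<open>w\<close> is the value of \<open>y\<close> at
  \<open>w\<close>, and dividing it by \<open>m w\<close> leaves \<open>c w\<close>. Representatives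
  are keys, so they have no repeated odd letter.\<close>

lemma weighted_invariants_orbit_sums:
  assumes y: "y \<in> weighted_invariants p m L d"
  obtains R c where "finite R" "\<And>w. w \<in> R \<Longrightarrow> length w = d \<and> set w \<subseteq> L \<and> distinct (filter p w)"
    "y = (\<Sum>w\<in>R. fscale (c w) (fscale (of_nat (m w)) (orbit_sum p w)))"
proof -
  have sym: "signed_symmetric p y"
    and key: "\<And>w. w \<in> Poly_Mapping.keys y \<Longrightarrow> length w = d \<and> set w \<subseteq> L"
    and dvd: "\<And>w. of_nat (m w) dvd Poly_Mapping.lookup y w"
    using y by (auto simp: weighted_invariants_def)
  obtain R where R: "finite R"
    "\<And>u. u \<in> R \<Longrightarrow> length u = d" "\<And>u. u \<in> R \<Longrightarrow> \<exists>v. u @ v \<in> Poly_Mapping.keys y"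
    "\<And>u v. length u = d \<Longrightarrow> Poly_Mapping.lookup y (u @ v) =
      (\<Sum>w\<in>R. Poly_Mapping.lookup (orbit_sum p w) u * Poly_Mapping.lookup y (w @ v))"
    by (rule signed_symmetric_prefixes[OF sym, of d]) (rule that)
  define c where "c w = (SOME c. Poly_Mapping.lookup y w = of_nat (m w) * c)" for w
  have c: "Poly_Mapping.lookup y w = of_nat (m w) * c w" for w
    unfolding c_def by (rule someI_ex) (use dvd[of w] in \<open>auto simp: dvd_def\<close>)
  show thesis
  proof
    show "finite R" by fact
    show "length w = d \<and> set w \<subseteq> L \<and> distinct (filter p w)" if w: "w \<in> R" for w
    proof -
      from R(3)[OF w] obtain v where "w @ v \<in> Poly_Mapping.keys y" ..
      with key[OF this] R(2)[OF w] have "w \<in> Poly_Mapping.keys y" by simp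
      with key[OF this] signed_symmetric_eq_0[OF sym] show ?thesis by (auto simp: in_keys_iff)
    qed
    show "y = (\<Sum>w\<in>R. fscale (c w) (fscale (of_nat (m w)) (orbit_sum p w)))"
    proof (rule poly_mapping_eqI)
      fix u
      show "Poly_Mapping.lookup y u =
        Poly_Mapping.lookup (\<Sum>w\<in>R. fscale (c w) (fscale (of_nat (m w)) (orbit_sum p w))) u"
      proof (cases "length u = d")
        case True
        with R(4)[of u "[]"] show ?thesis
          by (simp add: lookup_sum c mult_ac)
      next
        case False
        then have "u \<notin> Poly_Mapping.keys y" using key by blast
        moreover have "mset u \<noteq> mset w" if "w \<in> R" for w
          using False R(2)[OF that] mset_eq_length by blast
        ultimately show ?thesis by (simp add: lookup_sum lookup_orbit_sum in_keys_iff)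
      qed
    qed
  qed
qed

lemma cut_weighted_invariants:
  fixes y :: "'x list \<Rightarrow>\<^sub>0 'k::{idom, ring_char_0}"
  assumes m0: "\<And>w. m w \<noteq> 0" and m_cong: "\<And>u w. mset u = mset w \<Longrightarrow> m u = m w"
    and m_append: "\<And>u v. m u * m v dvd m (u @ v)"
    and y: "y \<in> weighted_invariants p m L d" and l: "l \<le> d"
  obtains R f g where "finite (R :: 'x list set)"
    "\<And>u. u \<in> R \<Longrightarrow> f u \<in> weighted_invariants p m L l"
    "\<And>u. u \<in> R \<Longrightarrow> g u \<in> weighted_invariants p m L (d - l)"
    "lin_ext (\<lambda>w. word (take l w, drop l w)) y = (\<Sum>u\<in>R. outer (f u) (g u))"
proof -
  have sym: "signed_symmetric p y"
    and key: "\<And>w. w \<in> Poly_Mapping.keys y \<Longrightarrow> length w = d \<and> set w \<subseteq> L"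
    and dvd: "\<And>w. of_nat (m w) dvd Poly_Mapping.lookup y w"
    using y by (auto simp: weighted_invariants_def)
  obtain R where R: "finite R"
    "\<And>u. u \<in> R \<Longrightarrow> length u = l" "\<And>u. u \<in> R \<Longrightarrow> \<exists>v. u @ v \<in> Poly_Mapping.keys y"
    "\<And>u v. length u = l \<Longrightarrow> Poly_Mapping.lookup y (u @ v) =
      (\<Sum>w\<in>R. Poly_Mapping.lookup (orbit_sum p w) u * Poly_Mapping.lookup y (w @ v))"
    by (rule signed_symmetric_prefixes[OF sym, of l]) (rule that)
  have ex: "\<exists>c. Poly_Mapping.lookup y (u @ v) = of_nat (m u) * (of_nat (m v) * c)" for u v
  proof -
    have "of_nat (m u * m v) dvd Poly_Mapping.lookup y (u @ v)"
      using m_append[of u v] dvd[of "u @ v"] by (elim dvdE) (simp add: mult.assoc)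
    then show ?thesis by (auto simp: dvd_def mult.assoc)
  qed
  \<comment> \<open>The coefficient of \<open>u @ v\<close> divided by both weights; it exists
    because \<open>m u * m v\<close> divides \<open>m (u @ v)\<close>.\<close>
  define c where
    "c u v = (SOME c. Poly_Mapping.lookup y (u @ v) = of_nat (m u) * (of_nat (m v) * c))" for u v
  have c: "Poly_Mapping.lookup y (u @ v) = of_nat (m u) * (of_nat (m v) * c u v)" for u v
    unfolding c_def by (rule someI_ex[OF ex])
  \<comment> \<open>Here \<open>m u\<close> is cancelled, as a nonzero scalar in a domain of
    characteristic 0. So \<open>g u\<close> is supported on suffixes of keys, hence on finitely many
    words.\<close>
  have c0: "of_nat (m v) * c u v = 0 \<longleftrightarrow> u @ v \<notin> Poly_Mapping.keys y" for u v
    using c[of u v] m0[of u] by (auto simp: in_keys_iff)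
  define g where "g u = Abs_poly_mapping (\<lambda>v. of_nat (m v) * c u v)" for u
  have lookup_g: "Poly_Mapping.lookup (g u) v = of_nat (m v) * c u v" for u v
  proof -
    have "{v. of_nat (m v) * c u v \<noteq> 0} \<subseteq> drop (length u) ` Poly_Mapping.keys y"
      unfolding c0 by (auto simp: image_iff intro!: bexI[of _ "u @ _"])
    then have "finite {v. of_nat (m v) * c u v \<noteq> 0}"
      by (rule finite_subset) simp
    then show ?thesis by (simp add: g_def)
  qed
  define f :: "'x list \<Rightarrow> ('x list \<Rightarrow>\<^sub>0 'k)" where "f u = fscale (of_nat (m u)) (orbit_sum p u)" for u
  show thesis
  proof
    show "finite R" by fact
    fix u assume u: "u \<in> R"
    show "f u \<in> weighted_invariants p m L l"
    proof -
      from R(3)[OF u] obtain v where "u @ v \<in> Poly_Mapping.keys y" ..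
      from key[OF this] R(2)[OF u] show ?thesis
        unfolding f_def by (intro orbit_sum_mem_weighted_invariants m_cong) auto
    qed
    have "signed_symmetric p (g u)"
      unfolding signed_symmetric_def
    proof (intro allI impI)
      fix w v :: "'x list" assume "mset v = mset w"
      \<comment> \<open>Symmetry in the suffix is known for \<open>m u\<close> times
        \<open>g u\<close>, and \<open>m u\<close> is cancelled again.\<close>
      from signed_symmetric_append_right[OF sym this, of u]
      have "of_nat (m u) * Poly_Mapping.lookup (g u) v =
          of_nat (m u) * (of_int (word_sign p w v) * Poly_Mapping.lookup (g u) w)"
        by (simp add: c lookup_g mult_ac)
      then show "Poly_Mapping.lookup (g u) v = of_int (word_sign p w v) * Poly_Mapping.lookup (g u) w"
        using m0[of u] by simp
    qed
    moreover have "length w = d - l \<and> set w \<subseteq> L" if "w \<in> Poly_Mapping.keys (g u)" for w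
      using that c0[of w u] key[of "u @ w"] R(2)[OF u] by (auto simp: in_keys_iff lookup_g)
    ultimately show "g u \<in> weighted_invariants p m L (d - l)"
      by (auto simp: weighted_invariants_def lookup_g)
  next
    show "lin_ext (\<lambda>w. word (take l w, drop l w)) y = (\<Sum>u\<in>R. outer (f u) (g u))"
    proof (rule poly_mapping_eqI, clarify)
      fix u v
      have "Poly_Mapping.lookup (lin_ext (\<lambda>w. word (take l w, drop l w)) y) (u, v) =
          (\<Sum>w\<in>Poly_Mapping.keys y. if w = u @ v then
             (if length u = l then Poly_Mapping.lookup y (u @ v) else 0) else 0)"
        unfolding lookup_lin_ext
      proof (intro sum.cong refl)
        fix w assume "w \<in> Poly_Mapping.keys y"
        then have "length w = d" using key by blast
        then have "(take l w, drop l w) = (u, v) \<longleftrightarrow> w = u @ v \<and> length u = l"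
          using l by (auto simp: append_eq_conv_conj)
        then show "Poly_Mapping.lookup y w * Poly_Mapping.lookup (word (take l w, drop l w)) (u, v) =
            (if w = u @ v then (if length u = l then Poly_Mapping.lookup y (u @ v) else 0) else 0)"
          by (auto simp: lookup_word)
      qed
      also have "\<dots> = (if length u = l then Poly_Mapping.lookup y (u @ v) else 0)"
        by (auto simp: in_keys_iff)
      also have "\<dots> = (\<Sum>w\<in>R. Poly_Mapping.lookup (orbit_sum p w) u * Poly_Mapping.lookup y (w @ v))"
      proof (cases "length u = l")
        case True
        with R(4)[of u v] show ?thesis by simp
      next
        case False
        then have "mset u \<noteq> mset w" if "w \<in> R" for w
          using R(2)[OF that] mset_eq_length by blast
        with False show ?thesis by (simp add: lookup_orbit_sum)
      qed
      also have "\<dots> = Poly_Mapping.lookup (\<Sum>u\<in>R. outer (f u) (g u)) (u, v)"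
        by (simp add: lookup_sum f_def c lookup_g mult_ac)
      finally show "Poly_Mapping.lookup (lin_ext (\<lambda>w. word (take l w, drop l w)) y) (u, v) =
        Poly_Mapping.lookup (\<Sum>u\<in>R. outer (f u) (g u)) (u, v)" .
    qed
  qed
qed

section \<open>The factorial weight of the letters from the complement\<close>

lemma c_factorial_superset:
  assumes "finite S" "set w \<subseteq> S"
  shows "c_factorial Bc w = (\<Prod>t | t \<in> S \<and> fst t \<in> Bc. fact (count_list w t))"
  unfolding c_factorial_def
proof (rule prod.mono_neutral_left)
  show "\<forall>t\<in>{t \<in> S. fst t \<in> Bc} - {t \<in> set w. fst t \<in> Bc}. fact (count_list w t) = 1"
  proof
    fix t assume "t \<in> {t \<in> S. fst t \<in> Bc} - {t \<in> set w. fst t \<in> Bc}"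
    then have "t \<notin> set w" by blast
    then show "fact (count_list w t) = 1" by simp
  qed
qed (use assms in auto)

lemma c_factorial_nonzero: "c_factorial Bc w \<noteq> 0"
  by (simp add: c_factorial_def)

lemma c_factorial_cong: "mset u = mset w \<Longrightarrow> c_factorial Bc u = c_factorial Bc w"
  using mset_eq_setD[of u w] by (simp add: c_factorial_def flip: count_mset)

text \<open>Letter by letter the quotient is a binomial coefficient. The products are extended to
  the common set of letters, where the new factors are 0! = 1.\<close>

lemma c_factorial_append: "c_factorial Bc u * c_factorial Bc v dvd c_factorial Bc (u @ v)"
proof -
  let ?S = "set u \<union> set v"
  have "c_factorial Bc u * c_factorial Bc v =
      (\<Prod>t | t \<in> ?S \<and> fst t \<in> Bc. fact (count_list u t) * fact (count_list v t))"
    by (simp add: c_factorial_superset[of ?S] prod.distrib)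
  also have "\<dots> dvd (\<Prod>t | t \<in> ?S \<and> fst t \<in> Bc. fact (count_list u t + count_list v t))"
    by (intro prod_dvd_prod fact_fact_dvd_fact)
  also have "\<dots> = c_factorial Bc (u @ v)"
    by (simp add: c_factorial_superset[of ?S])
  finally show ?thesis .
qed

section \<open>The tensor algebra of a free module\<close>

lemma coset_eq_iff: "x +o tensor_ker s = y +o tensor_ker s \<longleftrightarrow> x - y \<in> tensor_ker s"
proof
  assume "x +o tensor_ker s = y +o tensor_ker s"
  moreover have "x \<in> x +o tensor_ker s"
    by (simp add: mem_coset_iff fmod.subspace_0[OF subspace_tensor_ker])
  ultimately show "x - y \<in> tensor_ker s" by (simp add: mem_coset_iff)
qed (rule coset_eqI[OF subspace_tensor_ker])

lemma tensor_ker_trans: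
  "x - y \<in> tensor_ker s \<Longrightarrow> y - z \<in> tensor_ker s \<Longrightarrow> x - z \<in> tensor_ker s"
  using fmod.subspace_add[OF subspace_tensor_ker, of "x - y" s "y - z"] by simp

lemma tensor_ker_sym: "x - y \<in> tensor_ker s \<Longrightarrow> y - x \<in> tensor_ker s"
  using fmod.subspace_neg[OF subspace_tensor_ker, of "x - y" s] by simp

text \<open>The relations hold in an arbitrary context, so putting a letter in front maps each
  generator of the kernel to a generator.\<close>

lemma tensor_ker_Cons:
  assumes "z \<in> tensor_ker s"
  shows "lin_ext (\<lambda>w. word (X # w)) z \<in> tensor_ker s"
  using assms unfolding tensor_ker_def
proof (induction rule: fmod.span_induct)
  case (step z)
  then consider
    (add) u v x y where "z = word (u @ [x + y] @ v) - word (u @ [x] @ v) - word (u @ [y] @ v)"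
  | (scale) u v c x where "z = word (u @ [s c x] @ v) - fscale c (word (u @ [x] @ v))"
    unfolding tensor_rels_def by blast
  then have "lin_ext (\<lambda>w. word (X # w)) z \<in> tensor_ker s"
  proof cases
    case add
    then show ?thesis
      using tensor_ker_add[of "X # u" x y v s] by (simp add: lin_ext_diff)
  next
    case scale
    then show ?thesis
      using tensor_ker_scale[of "X # u" s c x v] by (simp add: lin_ext_diff lin_ext_fscale)
  qed
  then show ?case by (simp add: tensor_ker_def)
next
  case base
  show ?case
    by (auto simp: fmod.subspace_def lin_ext_add lin_ext_fscale fmod.span_zero
        intro: fmod.span_add fmod.span_scale)
qed

lemma word_sum_Cons:
  assumes "finite T"
  shows "word ((\<Sum>t\<in>T. s (c t) (e t)) # w) - (\<Sum>t\<in>T. fscale (c t) (word (e t # w))) \<in> tensor_ker s"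
  using assms
proof (induction T)
  case empty
  \<comment> \<open>Additivity for \<open>0 + 0\<close> collapses to
    \<open>- word (0 # w)\<close>.\<close>
  have "word ((0 + 0) # w) - word (0 # w) - word (0 # w) \<in> tensor_ker s"
    using tensor_ker_add[of "[]" 0 0 w s] by simp
  from fmod.subspace_neg[OF subspace_tensor_ker this] show ?case by simp
next
  case (insert t T)
  let ?S = "\<Sum>t\<in>T. s (c t) (e t)" and ?R = "\<Sum>t\<in>T. fscale (c t) (word (e t # w))"
  have "(word ((s (c t) (e t) + ?S) # w) - word (s (c t) (e t) # w) - word (?S # w))
      + (word (s (c t) (e t) # w) - fscale (c t) (word (e t # w))) + (word (?S # w) - ?R) \<in> tensor_ker s"
    using tensor_ker_add[of "[]" "s (c t) (e t)" ?S w s] tensor_ker_scale[of "[]" s "c t" "e t" w]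
      insert.IH by (intro fmod.subspace_add[OF subspace_tensor_ker]) simp_all
  then show ?case using insert.hyps by (simp add: algebra_simps)
qed

text \<open>The tensor algebra of a free module is identified, through \<open>expand\<close> and \<open>assemble\<close>, with the
  formal sums of words in the basis indices.\<close>

locale module_with_basis =
  fixes s :: "'k::comm_ring_1 \<Rightarrow> 'm::ab_group_add \<Rightarrow> 'm"
    and L :: "'t set" and elem :: "'t \<Rightarrow> 'm" and coord :: "'m \<Rightarrow> 't \<Rightarrow> 'k"
  assumes coord_add: "coord (X + Y) t = coord X t + coord Y t"
    and coord_scale: "coord (s c X) t = c * coord X t"
    and finite_coord: "finite {t. coord X t \<noteq> 0}"
    and coord_nonzero: "coord X t \<noteq> 0 \<Longrightarrow> t \<in> L"
    and coord_elem: "t \<in> L \<Longrightarrow> coord (elem t) u = (if u = t then 1 else 0)"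
    and sum_coord: "(\<Sum>t | coord X t \<noteq> 0. s (coord X t) (elem t)) = X"
begin

text \<open>Full multilinear expansion: the coefficient at \<open>ts\<close> is the product of the
  coordinates \<open>coord (Xs ! i) (ts ! i)\<close>, and 0 if the lengths differ.\<close>

primrec expand_word :: "'m list \<Rightarrow> ('t list \<Rightarrow>\<^sub>0 'k)" where
  "expand_word [] = word []"
| "expand_word (X # Xs) =
    (\<Sum>t | coord X t \<noteq> 0. fscale (coord X t) (lin_ext (\<lambda>ts. word (t # ts)) (expand_word Xs)))"

definition expand :: "('m list \<Rightarrow>\<^sub>0 'k) \<Rightarrow> ('t list \<Rightarrow>\<^sub>0 'k)" where
  "expand = lin_ext expand_word"

definition assemble :: "('t list \<Rightarrow>\<^sub>0 'k) \<Rightarrow> ('m list \<Rightarrow>\<^sub>0 'k)" where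
  "assemble = lin_ext (\<lambda>ts. word (map elem ts))"

lemma lookup_expand_word_Cons_Nil [simp]: "Poly_Mapping.lookup (expand_word (X # Xs)) [] = 0"
  by (simp add: lookup_sum lookup_lin_ext lookup_word)

lemma lookup_lin_ext_Cons:
  "Poly_Mapping.lookup (lin_ext (\<lambda>ts. word (t' # ts)) z) (t # ts) =
    (if t' = t then Poly_Mapping.lookup z ts else 0)"
proof -
  have "Poly_Mapping.lookup (lin_ext (\<lambda>ts. word (t' # ts)) z) (t # ts) =
      (\<Sum>us\<in>Poly_Mapping.keys z. if us = ts then (if t' = t then Poly_Mapping.lookup z ts else 0) else 0)"
    unfolding lookup_lin_ext by (intro sum.cong refl) (auto simp: lookup_word)
  also have "\<dots> = (if t' = t then Poly_Mapping.lookup z ts else 0)"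
    by (auto simp: in_keys_iff)
  finally show ?thesis .
qed

lemma lookup_expand_word_Cons [simp]:
  "Poly_Mapping.lookup (expand_word (X # Xs)) (t # ts) =
    coord X t * Poly_Mapping.lookup (expand_word Xs) ts"
proof -
  have "Poly_Mapping.lookup (expand_word (X # Xs)) (t # ts) = (\<Sum>t' | coord X t' \<noteq> 0.
      if t' = t then coord X t * Poly_Mapping.lookup (expand_word Xs) ts else 0)"
    by (simp add: lookup_sum lookup_lin_ext_Cons if_distrib cong: if_cong)
  also have "\<dots> = coord X t * Poly_Mapping.lookup (expand_word Xs) ts"
    using finite_coord[of X] by simp
  finally show ?thesis .
qed

declare expand_word.simps(2) [simp del]

lemma lookup_expand_word_nonzero:
  "Poly_Mapping.lookup (expand_word Xs) ts \<noteq> 0 \<Longrightarrow> length ts = length Xs \<and> set ts \<subseteq> L"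
proof (induction Xs arbitrary: ts)
  case Nil
  then show ?case by (auto simp: lookup_word split: if_splits)
next
  case (Cons X Xs)
  from Cons.prems obtain t us where ts: "ts = t # us" by (cases ts) auto
  with Cons.prems have "coord X t \<noteq> 0" "Poly_Mapping.lookup (expand_word Xs) us \<noteq> 0" by auto
  with Cons.IH coord_nonzero ts show ?case by auto
qed

lemma lookup_expand_word_add:
  "Poly_Mapping.lookup (expand_word (u @ (x + y) # v)) ts =
    Poly_Mapping.lookup (expand_word (u @ x # v)) ts + Poly_Mapping.lookup (expand_word (u @ y # v)) ts"
proof (induction u arbitrary: ts)
  case Nil
  then show ?case by (cases ts) (simp_all add: coord_add algebra_simps)
next
  case (Cons a u)
  then show ?case by (cases ts) (simp_all add: algebra_simps)
qed

lemma lookup_expand_word_scale: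
  "Poly_Mapping.lookup (expand_word (u @ s c x # v)) ts =
    c * Poly_Mapping.lookup (expand_word (u @ x # v)) ts"
proof (induction u arbitrary: ts)
  case Nil
  then show ?case by (cases ts) (simp_all add: coord_scale algebra_simps)
next
  case (Cons a u)
  then show ?case by (cases ts) (simp_all add: algebra_simps)
qed

text \<open>Products of coordinates are linear in each letter, so \<open>expand\<close> descends to
  the tensor algebra. Hence a tensor determines its coefficients: words in the basis stay linearly
  independent modulo the kernel.\<close>

lemma expand_tensor_ker:
  assumes "z \<in> tensor_ker s"
  shows "expand z = 0"
  using assms unfolding tensor_ker_def
proof (induction rule: fmod.span_induct)
  case (step z)
  then show ?case
    unfolding tensor_rels_def expand_def
    by (auto simp: lin_ext_diff lin_ext_fscale lookup_minus
        lookup_expand_word_add lookup_expand_word_scale intro!: poly_mapping_eqI)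
next
  case base
  show ?case
    by (auto simp: fmod.subspace_def expand_def lin_ext_add lin_ext_fscale)
qed

lemma expand_cong: "x - y \<in> tensor_ker s \<Longrightarrow> expand x = expand y"
  using expand_tensor_ker[of "x - y"] by (simp add: expand_def lin_ext_diff)

lemma expand_word_map_elem: "set ts \<subseteq> L \<Longrightarrow> expand_word (map elem ts) = word ts"
proof (induction ts)
  case (Cons t ts)
  show ?case
  proof (rule poly_mapping_eqI)
    fix us
    show "Poly_Mapping.lookup (expand_word (map elem (t # ts))) us =
        Poly_Mapping.lookup (word (t # ts)) us"
      using Cons by (cases us) (auto simp: lookup_word coord_elem)
  qed
qed simp

lemma expand_assemble:
  assumes "\<And>w. w \<in> Poly_Mapping.keys y \<Longrightarrow> set w \<subseteq> L"
  shows "expand (assemble y) = y"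
proof -
  have "expand (assemble y) = lin_ext word y"
    unfolding expand_def assemble_def lin_ext_lin_ext
    by (rule lin_ext_cong) (simp add: expand_word_map_elem assms)
  then show ?thesis by simp
qed

text \<open>Words in the basis span modulo the relations: the first letter is expanded by
  multilinearity, the rest by induction behind a fixed first letter.\<close>

lemma assemble_expand_word: "assemble (expand_word Xs) - word Xs \<in> tensor_ker s"
proof (induction Xs)
  case Nil
  then show ?case using fmod.subspace_0[OF subspace_tensor_ker] by (simp add: assemble_def)
next
  case (Cons X Xs)
  let ?T = "{t. coord X t \<noteq> 0}"
  let ?c = "\<lambda>Y. lin_ext (\<lambda>w. word (Y # w)) :: ('m list \<Rightarrow>\<^sub>0 'k) \<Rightarrow> _"
  have "assemble (expand_word (X # Xs)) - (\<Sum>t\<in>?T. fscale (coord X t) (word (elem t # Xs))) =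
      (\<Sum>t\<in>?T. fscale (coord X t) (?c (elem t) (assemble (expand_word Xs) - word Xs)))"
    by (simp add: assemble_def expand_word.simps(2) lin_ext_sum lin_ext_fscale lin_ext_lin_ext
        lin_ext_diff fmod.scale_right_diff_distrib sum_subtractf)
  also have "\<dots> \<in> tensor_ker s"
    by (intro fmod.subspace_sum[OF subspace_tensor_ker] fmod.subspace_scale[OF subspace_tensor_ker]
        tensor_ker_Cons Cons.IH)
  finally show ?case
  proof (rule tensor_ker_trans[OF _ tensor_ker_sym])
    show "word (X # Xs) - (\<Sum>t\<in>?T. fscale (coord X t) (word (elem t # Xs))) \<in> tensor_ker s"
      using word_sum_Cons[OF finite_coord, of s "coord X" elem X Xs] by (simp add: sum_coord)
  qed
qed

lemma assemble_expand: "assemble (expand x) - x \<in> tensor_ker s"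
proof -
  have "lin_ext (\<lambda>w. assemble (expand_word w)) x - lin_ext word x \<in> tensor_ker s"
    by (intro lin_ext_diff_mem[OF subspace_tensor_ker] assemble_expand_word)
  then show ?thesis by (simp add: expand_def assemble_def lin_ext_lin_ext)
qed

lemma keys_expand:
  assumes "t \<in> Poly_Mapping.keys (expand x)"
  obtains w where "w \<in> Poly_Mapping.keys x" "length t = length w" "set t \<subseteq> L"
proof -
  have "Poly_Mapping.lookup (expand x) t \<noteq> 0" using assms by (simp add: in_keys_iff)
  then obtain w where "w \<in> Poly_Mapping.keys x" "Poly_Mapping.lookup (expand_word w) t \<noteq> 0"
    unfolding expand_def lookup_lin_ext by (metis (no_types, lifting) mult_zero_right sum.neutral)
  with lookup_expand_word_nonzero that show thesis by blast
qed

lemma keys_assemble: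
  assumes "w \<in> Poly_Mapping.keys (assemble y)"
  obtains t where "t \<in> Poly_Mapping.keys y" "w = map elem t"
proof -
  have "Poly_Mapping.lookup (assemble y) w \<noteq> 0" using assms by (simp add: in_keys_iff)
  then obtain t where "t \<in> Poly_Mapping.keys y" "Poly_Mapping.lookup (word (map elem t)) w \<noteq> (0 :: 'k)"
    unfolding assemble_def lookup_lin_ext by (metis (no_types, lifting) mult_zero_right sum.neutral)
  with that show thesis by (auto simp: lookup_word split: if_splits)
qed

lemma assemble_fscale: "assemble (fscale c x) = fscale c (assemble x)"
  and assemble_sum: "assemble (sum g I) = (\<Sum>i\<in>I. assemble (g i))"
  by (simp_all add: assemble_def lin_ext_fscale lin_ext_sum)

end

section \<open>Stabilizer cosets and the signed action on words\<close>

lemma perm_list_inv: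
  assumes "\<sigma> permutes {..<length w}"
  shows "perm_list (inv \<sigma>) (perm_list \<sigma> w) = w" "perm_list \<sigma> (perm_list (inv \<sigma>) w) = w"
  using permute_list_compose[OF permutes_inv[OF assms], of \<sigma>]
    permute_list_compose[OF assms, of "inv \<sigma>"] assms
  by (simp_all add: perm_list_eq_permute_list permutes_inv_o)

text \<open>Orbit-stabilizer for a right action. As \<open>perm_list (\<tau> \<circ> \<sigma>) w =
  perm_list \<sigma> (perm_list \<tau> w)\<close>, the stabilizer acts first, all members of a coset
  carry \<open>w\<close> to the same word, and it does not matter which one \<open>SOME\<close>
  picks.\<close>

lemma bij_betw_stabilizer_cosets:
  "bij_betw (\<lambda>C. perm_list (SOME \<sigma>. \<sigma> \<in> C) w) (stabilizer_cosets w) {u. mset u = mset w}"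
proof -
  define coset :: "(nat \<Rightarrow> nat) \<Rightarrow> (nat \<Rightarrow> nat) set" where "coset \<sigma> = (\<lambda>\<tau>. \<tau> \<circ> \<sigma>) ` stabilizer w" for \<sigma>
  let ?P = "{\<sigma>. \<sigma> permutes {..<length w}}"
  have comp: "perm_list (\<tau> \<circ> \<sigma>) w = perm_list \<sigma> (perm_list \<tau> w)" if "\<sigma> \<in> ?P" for \<sigma> \<tau>
    using that by (simp add: perm_list_eq_permute_list permute_list_compose)
  have some: "(SOME \<rho>. \<rho> \<in> coset \<sigma>) \<in> coset \<sigma>" if "\<sigma> \<in> ?P" for \<sigma>
  proof -
    have "id \<in> stabilizer w"
      using permutes_id by (simp add: stabilizer_def perm_list_eq_permute_list)
    then have "id \<circ> \<sigma> \<in> coset \<sigma>" unfolding coset_def by (rule imageI)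
    then show ?thesis by (rule someI[of "\<lambda>\<rho>. \<rho> \<in> coset \<sigma>"])
  qed
  have some_perm: "perm_list (SOME \<rho>. \<rho> \<in> coset \<sigma>) w = perm_list \<sigma> w" if "\<sigma> \<in> ?P" for \<sigma>
  proof -
    from some[OF that] obtain \<tau> where "\<tau> \<in> stabilizer w" "(SOME \<rho>. \<rho> \<in> coset \<sigma>) = \<tau> \<circ> \<sigma>"
      unfolding coset_def by blast
    then show ?thesis using comp[OF that, of \<tau>] by (simp add: stabilizer_def)
  qed
  have sub: "coset \<sigma> \<subseteq> coset \<sigma>'"
    if \<sigma>: "\<sigma> \<in> ?P" and \<sigma>': "\<sigma>' \<in> ?P" and eq: "perm_list \<sigma> w = perm_list \<sigma>' w" for \<sigma> \<sigma>'
  proof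
    fix \<rho> assume "\<rho> \<in> coset \<sigma>"
    then obtain \<tau> where \<tau>: "\<tau> \<in> stabilizer w" "\<rho> = \<tau> \<circ> \<sigma>" by (auto simp: coset_def)
    have "\<rho> permutes {..<length w}"
      using \<tau> \<sigma> by (auto simp: stabilizer_def intro: permutes_compose)
    then have "\<rho> \<circ> inv \<sigma>' permutes {..<length w}"
      using \<sigma>' by (auto intro: permutes_compose permutes_inv)
    moreover have "perm_list (\<rho> \<circ> inv \<sigma>') w = w"
      using \<tau> \<sigma> \<sigma>' eq comp[OF \<sigma>, of \<tau>] comp[of "inv \<sigma>'" \<rho>] perm_list_inv[of \<sigma>' w]
      by (simp add: stabilizer_def permutes_inv)
    ultimately have "\<rho> \<circ> inv \<sigma>' \<in> stabilizer w" by (simp add: stabilizer_def)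
    moreover have "\<rho> = (\<rho> \<circ> inv \<sigma>') \<circ> \<sigma>'"
      using \<sigma>' by (simp add: comp_assoc permutes_inv_o)
    ultimately show "\<rho> \<in> coset \<sigma>'" unfolding coset_def by blast
  qed
  have cosets: "stabilizer_cosets w = coset ` ?P"
    by (simp add: stabilizer_cosets_def coset_def)
  have "inj_on (\<lambda>C. perm_list (SOME \<sigma>. \<sigma> \<in> C) w) (stabilizer_cosets w)"
    unfolding cosets
  proof (rule inj_onI, elim imageE)
    fix C C' \<sigma> \<sigma>'
    assume "perm_list (SOME \<sigma>. \<sigma> \<in> C) w = perm_list (SOME \<sigma>. \<sigma> \<in> C') w"
      and C: "C = coset \<sigma>" "\<sigma> \<in> ?P" "C' = coset \<sigma>'" "\<sigma>' \<in> ?P"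
    then have "perm_list \<sigma> w = perm_list \<sigma>' w" by (simp add: some_perm)
    with C sub[of \<sigma> \<sigma>'] sub[of \<sigma>' \<sigma>] show "C = C'" by simp
  qed
  moreover have "(\<lambda>C. perm_list (SOME \<sigma>. \<sigma> \<in> C) w) ` stabilizer_cosets w = {u. mset u = mset w}"
  proof (intro equalityI subsetI)
    fix u assume "u \<in> (\<lambda>C. perm_list (SOME \<sigma>. \<sigma> \<in> C) w) ` stabilizer_cosets w"
    then obtain \<sigma> where "\<sigma> \<in> ?P" "u = perm_list \<sigma> w" by (auto simp: cosets some_perm)
    then show "u \<in> {u. mset u = mset w}" by (simp add: perm_list_eq_permute_list)
  next
    fix u assume "u \<in> {u. mset u = mset w}"
    then have "mset u = mset w" by simp
    then obtain \<sigma> where "\<sigma> permutes {..<length w}" "perm_list \<sigma> w = u"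
      unfolding perm_list_eq_permute_list by (rule mset_eq_permutation)
    then show "u \<in> (\<lambda>C. perm_list (SOME \<sigma>. \<sigma> \<in> C) w) ` stabilizer_cosets w"
      unfolding cosets image_image by (auto simp: some_perm image_iff)
  qed
  ultimately show ?thesis by (simp add: bij_betw_def)
qed

lemma some_mem_stabilizer_coset:
  assumes "C \<in> stabilizer_cosets w"
  shows "(SOME \<sigma>. \<sigma> \<in> C) permutes {..<length w}"
proof -
  from assms obtain \<sigma> where \<sigma>: "\<sigma> permutes {..<length w}"
    and C: "C = (\<lambda>\<tau>. \<tau> \<circ> \<sigma>) ` stabilizer w"
    by (auto simp: stabilizer_cosets_def)
  have "id \<in> stabilizer w"
    using permutes_id by (simp add: stabilizer_def perm_list_eq_permute_list)
  then have "id \<circ> \<sigma> \<in> C" unfolding C by (rule imageI)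
  then have "(SOME \<sigma>. \<sigma> \<in> C) \<in> C" by (rule someI[of "\<lambda>\<sigma>. \<sigma> \<in> C"])
  with C \<sigma> show ?thesis
    by (auto simp: stabilizer_def intro: permutes_compose)
qed

text \<open>The coordinate form of \<open>perm_word\<close>: the letters are homogeneous, so modulo
  the kernel one of the \<open>2 ^ d\<close> terms survives.\<close>

definition signed_perm ::
    "('x \<Rightarrow> bool) \<Rightarrow> (nat \<Rightarrow> nat) \<Rightarrow> ('x list \<Rightarrow>\<^sub>0 'k::comm_ring_1) \<Rightarrow> ('x list \<Rightarrow>\<^sub>0 'k)" where
  "signed_perm p \<sigma> =
     lin_ext (\<lambda>w. fscale ((- 1) ^ odd_inversions \<sigma> (map p w)) (word (perm_list \<sigma> w)))"

lemma lookup_signed_perm: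
  assumes "\<And>w. w \<in> Poly_Mapping.keys y \<Longrightarrow> length w = d" "\<sigma> permutes {..<d}" "length u = d"
  shows "Poly_Mapping.lookup (signed_perm p \<sigma> y) (perm_list \<sigma> u) =
    (- 1) ^ odd_inversions \<sigma> (map p u) * Poly_Mapping.lookup y u"
proof -
  have "Poly_Mapping.lookup (signed_perm p \<sigma> y) (perm_list \<sigma> u) =
      (\<Sum>w\<in>Poly_Mapping.keys y. if w = u
        then (- 1) ^ odd_inversions \<sigma> (map p u) * Poly_Mapping.lookup y u else 0)"
    unfolding signed_perm_def lookup_lin_ext
  proof (intro sum.cong refl)
    fix w assume "w \<in> Poly_Mapping.keys y"
    then have "perm_list \<sigma> w = perm_list \<sigma> u \<longleftrightarrow> w = u"
      using assms perm_list_inv(1)[of \<sigma> w] perm_list_inv(1)[of \<sigma> u] by metis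
    then show "Poly_Mapping.lookup y w * Poly_Mapping.lookup
        (fscale ((- 1) ^ odd_inversions \<sigma> (map p w)) (word (perm_list \<sigma> w))) (perm_list \<sigma> u) =
        (if w = u then (- 1) ^ odd_inversions \<sigma> (map p u) * Poly_Mapping.lookup y u else 0)"
      by (auto simp: lookup_word)
  qed
  also have "\<dots> = (- 1) ^ odd_inversions \<sigma> (map p u) * Poly_Mapping.lookup y u"
    by (auto simp: in_keys_iff)
  finally show ?thesis .
qed

lemma keys_signed_perm:
  assumes "w \<in> Poly_Mapping.keys (signed_perm p \<sigma> y)"
  obtains u where "u \<in> Poly_Mapping.keys y" "w = perm_list \<sigma> u"
proof -
  have "Poly_Mapping.lookup (signed_perm p \<sigma> y) w \<noteq> 0" using assms by (simp add: in_keys_iff)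
  then have "\<exists>u\<in>Poly_Mapping.keys y. w = perm_list \<sigma> u"
    by (rule contrapos_np) (auto simp: signed_perm_def lookup_lin_ext lookup_word intro!: sum.neutral)
  with that show thesis by blast
qed

lemma signed_perm_eq:
  assumes y: "signed_symmetric p y" "\<And>w. w \<in> Poly_Mapping.keys y \<Longrightarrow> length w = d"
    and \<sigma>: "\<sigma> permutes {..<d}"
  shows "signed_perm p \<sigma> y = y"
proof (rule poly_mapping_eqI)
  fix w
  show "Poly_Mapping.lookup (signed_perm p \<sigma> y) w = Poly_Mapping.lookup y w"
  proof (cases "length w = d")
    case True
    define u where "u = perm_list (inv \<sigma>) w"
    have u: "perm_list \<sigma> u = w" "length u = d"
      using True \<sigma> perm_list_inv(2)[of \<sigma> w] by (simp_all add: u_def perm_list_eq_permute_list)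
    then have "Poly_Mapping.lookup (signed_perm p \<sigma> y) (perm_list \<sigma> u) =
        Poly_Mapping.lookup y (perm_list \<sigma> u)"
      using signed_symmetric_perm_list[OF y(1), of \<sigma> u] \<sigma> lookup_signed_perm[OF y(2) \<sigma> u(2)]
      by simp
    then show ?thesis by (simp add: u)
  next
    case False
    have "w \<notin> Poly_Mapping.keys y" using False y(2) by blast
    moreover have "w \<notin> Poly_Mapping.keys (signed_perm p \<sigma> y)"
    proof
      assume "w \<in> Poly_Mapping.keys (signed_perm p \<sigma> y)"
      then obtain u where "u \<in> Poly_Mapping.keys y" "w = perm_list \<sigma> u" by (rule keys_signed_perm)
      with y(2) False show False by (simp add: perm_list_eq_permute_list)
    qed
    ultimately show ?thesis by (simp add: in_keys_iff)
  qed
qed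

section \<open>Auxiliary facts on outer products, spans and independence\<close>

lemma outer_sum_left: "outer (sum f I) y = (\<Sum>i\<in>I. outer (f i) y)"
  by (rule poly_mapping_eqI) (auto simp: lookup_sum sum_distrib_right)

lemma outer_sum_right: "outer x (sum f I) = (\<Sum>i\<in>I. outer x (f i))"
  by (rule poly_mapping_eqI) (auto simp: lookup_sum sum_distrib_left)

text \<open>Cutting yields outer products of coordinate functions; this turns each tensor factor
  into matrices separately.\<close>

lemma lin_ext_outer:
  "lin_ext (\<lambda>x. word (g (fst x), h (snd x))) (outer x y) =
    outer (lin_ext (\<lambda>w. word (g w)) x) (lin_ext (\<lambda>w. word (h w)) y)"
proof -
  have "outer (lin_ext (\<lambda>w. word (g w)) x) (lin_ext (\<lambda>w. word (h w)) y) =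
      (\<Sum>u\<in>Poly_Mapping.keys x. \<Sum>v\<in>Poly_Mapping.keys y.
        outer (fscale (Poly_Mapping.lookup x u) (word (g u))) (fscale (Poly_Mapping.lookup y v) (word (h v))))"
    unfolding lin_ext_def outer_sum_left by (simp only: outer_sum_right)
  then show ?thesis
    by (simp add: outer_def[of x y] lin_ext_sum outer_fscale_left outer_fscale_right outer_word mult.commute)
qed

lemma quot_span_base: "x +o R \<in> X \<Longrightarrow> 0 \<in> R \<Longrightarrow> x +o R \<in> quot_span R X"
  unfolding quot_span_def by (rule imageI, rule fmod.span_base, rule UnionI, assumption) (simp add: mem_coset_iff)

text \<open>The parts of a vanishing combination inside and outside \<open>S\<close> are opposite,
  so both lie in \<open>span S \<inter> span T\<close> and are 0.\<close>

lemma (in module) independent_Un: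
  assumes S: "independent S" and T: "independent T" and ST: "span S \<inter> span T \<subseteq> {0}"
  shows "independent (S \<union> T)"
  unfolding independent_explicit_module
proof (intro allI impI)
  fix t u v assume t: "finite t" "t \<subseteq> S \<union> T" "(\<Sum>v\<in>t. scale (u v) v) = 0" "v \<in> t"
  let ?x = "\<Sum>v\<in>t \<inter> S. scale (u v) v" and ?y = "\<Sum>v\<in>t - S. scale (u v) v"
  have sum: "?x + ?y = 0"
    using t(1,3) by (simp add: sum.Int_Diff[of t _ S])
  have "?x \<in> span S" by (intro span_sum span_scale span_base) auto
  moreover have "?y \<in> span T" using t(2) by (intro span_sum span_scale span_base) auto
  moreover have "?x = - ?y" using sum by (simp add: eq_neg_iff_add_eq_0)
  ultimately have "?x = 0" using ST span_neg by fastforce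
  with sum have "?y = 0" by simp
  show "u v = 0"
  proof (cases "v \<in> S")
    case True
    then show ?thesis using independentD[OF S _ _ \<open>?x = 0\<close>, of v] t by auto
  next
    case False
    then show ?thesis using independentD[OF T _ _ \<open>?y = 0\<close>, of v] t by auto
  qed
qed

section \<open>The basis of matrix units\<close>

context good_pair_basis
begin

lemma basis_independent: "independent (Ba \<union> Bc \<union> B1)"
proof (intro independent_Un)
  have spans: "span Ba = \<aa>" "span Bc = \<cc>" "span B1 = A1"
    using basis_sub basis_compl basis_odd by (auto simp: basis_of_def)
  show "independent Ba" "independent Bc" "independent B1"
    using basis_sub basis_compl basis_odd by (auto simp: basis_of_def)
  show "span Ba \<inter> span Bc \<subseteq> {0}" using compl_Int spans by simp
  have "span (Ba \<union> Bc) \<subseteq> A0"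
    using span_superset[of Ba] span_superset[of Bc] sub_even compl_sub spans
    by (intro span_minimal subspace_even) auto
  then show "span (Ba \<union> Bc) \<inter> span B1 \<subseteq> {0}" using even_odd_Int spans by auto
qed

lemma basis_span: "x \<in> span (Ba \<union> Bc \<union> B1)"
proof -
  let ?B = "Ba \<union> Bc \<union> B1"
  have sub: "\<aa> \<subseteq> span ?B" "\<cc> \<subseteq> span ?B" "A1 \<subseteq> span ?B"
    using basis_sub basis_compl basis_odd span_mono[of Ba ?B] span_mono[of Bc ?B] span_mono[of B1 ?B]
    by (auto simp: basis_of_def)
  obtain y z where "y \<in> A0" "z \<in> A1" "x = y + z" using even_odd_sum by blast
  moreover obtain a c where "a \<in> \<aa>" "c \<in> \<cc>" "y = a + c" using compl_sum[OF \<open>y \<in> A0\<close>] by blast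
  ultimately show ?thesis using sub by (auto intro!: span_add)
qed

text \<open>Membership in \<open>A0\<close>, by which \<open>Tri\<close> tells the even basis
  elements, can thus serve as the parity in the signs.\<close>

lemma basis_parity: "b \<in> Ba \<union> Bc \<union> B1 \<Longrightarrow> b \<in> (if b \<notin> A0 then A1 else A0)"
  using basis_sub basis_compl basis_odd sub_even compl_sub
    span_superset[of Ba] span_superset[of Bc] span_superset[of B1]
  by (auto simp: basis_of_def)

abbreviation index_set :: "('a \<times> 'n \<times> 'n) set" where
  "index_set \<equiv> (Ba \<union> Bc \<union> B1) \<times> UNIV"

definition unit_matrix :: "'a \<times> 'n \<times> 'n \<Rightarrow> 'a^'n^'n" where
  "unit_matrix = (\<lambda>(b, r, s). mat_elem b r s)"

definition mat_coord :: "'a^'n^'n \<Rightarrow> 'a \<times> 'n \<times> 'n \<Rightarrow> 'k" where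
  "mat_coord X = (\<lambda>(b, r, s). representation (Ba \<union> Bc \<union> B1) (X $ r $ s) b)"

lemma finite_mat_coord:
  fixes X :: "'a^'n::finite^'n"
  shows "finite {t. mat_coord X t \<noteq> 0}"
proof (rule finite_subset)
  show "{t. mat_coord X t \<noteq> 0} \<subseteq>
      (\<Union>(r, s)\<in>UNIV. (\<lambda>b. (b, r, s)) ` {b. representation (Ba \<union> Bc \<union> B1) (X $ r $ s) b \<noteq> 0})"
    by (auto simp: mat_coord_def)
qed (auto intro!: finite_imageI finite_representation)

lemma sum_mat_coord:
  fixes X :: "'a^'n::finite^'n"
  shows "(\<Sum>t | mat_coord X t \<noteq> 0. mat_scale smul (mat_coord X t) (unit_matrix t)) = X"
  unfolding vec_eq_iff
proof (intro allI)
  fix i j :: 'n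
  let ?rep = "representation (Ba \<union> Bc \<union> B1) (X $ i $ j)"
  let ?f = "\<lambda>t. if snd t = (i, j) then smul (mat_coord X t) (fst t) else 0"
  have "(\<Sum>t | mat_coord X t \<noteq> 0. mat_scale smul (mat_coord X t) (unit_matrix t)) $ i $ j =
      (\<Sum>t | mat_coord X t \<noteq> 0. ?f t)"
    unfolding sum_component by (intro sum.cong refl) (auto simp: mat_scale_def unit_matrix_def mat_elem_def)
  also have "\<dots> = (\<Sum>t\<in>(\<lambda>b. (b, i, j)) ` {b. ?rep b \<noteq> 0}. ?f t)"
    by (rule sum.mono_neutral_right[OF finite_mat_coord]) (auto simp: mat_coord_def image_iff)
  also have "\<dots> = (\<Sum>b | ?rep b \<noteq> 0. smul (?rep b) b)"
    by (subst sum.reindex) (auto simp: inj_on_def mat_coord_def)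
  also have "\<dots> = X $ i $ j"
    by (rule sum_nonzero_representation_eq[OF basis_independent basis_span])
  finally show "(\<Sum>t | mat_coord X t \<noteq> 0. mat_scale smul (mat_coord X t) (unit_matrix t)) $ i $ j =
    X $ i $ j" .
qed

lemma module_with_basis_matrices:
  "module_with_basis (mat_scale smul) (index_set :: ('a \<times> 'n::finite \<times> 'n) set) unit_matrix mat_coord"
proof
  fix X Y :: "'a^'n^'n" and t u :: "'a \<times> 'n \<times> 'n" and c
  show "mat_coord (X + Y) t = mat_coord X t + mat_coord Y t"
    by (cases t) (simp add: mat_coord_def representation_add[OF basis_independent basis_span basis_span])
  show "mat_coord (mat_scale smul c X) t = c * mat_coord X t"
    by (cases t) (simp add: mat_coord_def mat_scale_def
        representation_scale[OF basis_independent basis_span])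
  show "finite {t. mat_coord X t \<noteq> 0}" by (rule finite_mat_coord)
  show "t \<in> index_set" if "mat_coord X t \<noteq> 0"
    using that representation_ne_zero by (cases t) (auto simp: mat_coord_def)
  show "mat_coord (unit_matrix t) u = (if u = t then 1 else 0)" if "t \<in> index_set"
    using that by (cases t; cases u)
      (auto simp: mat_coord_def unit_matrix_def mat_elem_def representation_zero
        representation_basis[OF basis_independent])
  show "(\<Sum>t | mat_coord X t \<noteq> 0. mat_scale smul (mat_coord X t) (unit_matrix t)) = X"
    by (rule sum_mat_coord)
qed

interpretation matrices: module_with_basis "mat_scale smul" index_set unit_matrix mat_coord
  by (rule module_with_basis_matrices)

section \<open>The group action and the orbit sums in coordinates\<close>

abbreviation odd_index :: "'a \<times> 'n \<times> 'n \<Rightarrow> bool" where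
  "odd_index t \<equiv> fst t \<notin> A0"

lemma Tri_iff:
  "w \<in> Tri A0 (Ba \<union> Bc \<union> B1) d \<longleftrightarrow>
    length w = d \<and> set w \<subseteq> index_set \<and> distinct (filter odd_index w)"
  unfolding Tri_def distinct_filter_nth_iff by auto

lemma perm_word_map_unit_matrix:
  fixes w :: "('a \<times> 'n::finite \<times> 'n) list"
  assumes \<sigma>: "\<sigma> permutes {..<length w}" and w: "set w \<subseteq> index_set"
  shows "perm_word A0 A1 (length w) \<sigma> (map unit_matrix w) -
    fscale ((- 1) ^ odd_inversions \<sigma> (map odd_index w)) (word (map unit_matrix (perm_list \<sigma> w)))
    \<in> tensor_ker (mat_scale smul)"
proof -
  have lt: "\<sigma> k < length w" if "k < length w" for k
    using permutes_in_image[OF \<sigma>, of k] that by simp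
  have letters: "map (\<lambda>k. mat_elem (fst (w ! f k)) (fst (snd (w ! f k))) (snd (snd (w ! f k)))) [0..<length w] =
      map unit_matrix (map (\<lambda>k. w ! f k) [0..<length w])" for f
    by (simp add: unit_matrix_def case_prod_unfold)
  have "fst (w ! k) \<in> (if map odd_index w ! k then A1 else A0)" if "k < length w" for k
  proof -
    have "w ! k \<in> index_set" using w nth_mem[OF that] by blast
    then show ?thesis using basis_parity[of "fst (w ! k)"] that by (simp add: mem_Times_iff)
  qed
  from perm_action_mat_elem[OF \<sigma> _ this, of "\<lambda>k. fst (snd (w ! k))" "\<lambda>k. snd (snd (w ! k))"]
  show ?thesis
    using letters[of "\<lambda>k. k"] letters[of \<sigma>]
    by (simp add: perm_action_coset[OF \<sigma>] coset_eq_iff map_nth perm_list_def)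
qed

text \<open>Intertwines the action with \<open>signed_perm\<close>, so that invariance of a tensor
  can be tested on its coordinates.\<close>

lemma perm_word_assemble:
  fixes y :: "('a \<times> 'n::finite \<times> 'n) list \<Rightarrow>\<^sub>0 'k"
  assumes \<sigma>: "\<sigma> permutes {..<d}"
    and y: "\<And>w. w \<in> Poly_Mapping.keys y \<Longrightarrow> length w = d \<and> set w \<subseteq> index_set"
  shows "lin_ext (perm_word A0 A1 d \<sigma>) (matrices.assemble y) -
    matrices.assemble (signed_perm odd_index \<sigma> y) \<in> tensor_ker (mat_scale smul)"
proof -
  have "lin_ext (\<lambda>w. perm_word A0 A1 d \<sigma> (map unit_matrix w)) y -
      lin_ext (\<lambda>w. fscale ((- 1) ^ odd_inversions \<sigma> (map odd_index w))
        (word (map unit_matrix (perm_list \<sigma> w)))) y \<in> tensor_ker (mat_scale smul)"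
  proof (rule lin_ext_diff_mem[OF subspace_tensor_ker])
    fix w assume "w \<in> Poly_Mapping.keys y"
    from y[OF this] perm_word_map_unit_matrix[of \<sigma> w] \<sigma>
    show "perm_word A0 A1 d \<sigma> (map unit_matrix w) -
      fscale ((- 1) ^ odd_inversions \<sigma> (map odd_index w)) (word (map unit_matrix (perm_list \<sigma> w)))
      \<in> tensor_ker (mat_scale smul)" by auto
  qed
  then show ?thesis
    by (simp add: matrices.assemble_def signed_perm_def lin_ext_lin_ext lin_ext_fscale)
qed

text \<open>Cosets are exchanged for rearrangements by the orbit bijection. Membership in
  \<open>Tri\<close> gives \<open>w\<close> sign 1 with respect to itself, so the sign of a chosen
  permutation is the \<open>word_sign\<close> of the word it produces and does not depend on the
  choice.\<close>

lemma xi_rep_assemble: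
  fixes w :: "('a \<times> 'n::finite \<times> 'n) list"
  assumes w: "w \<in> Tri A0 (Ba \<union> Bc \<union> B1) d"
  shows "xi_rep A0 A1 w - matrices.assemble (orbit_sum odd_index w :: _ \<Rightarrow>\<^sub>0 'k) \<in>
    tensor_ker (mat_scale smul)"
proof -
  let ?t = "\<lambda>C. SOME \<sigma>. \<sigma> \<in> C"
  let ?m = "\<lambda>u. fscale (of_int (word_sign odd_index w u)) (word (map unit_matrix u)) :: ('a^'n^'n) list \<Rightarrow>\<^sub>0 'k"
  have set: "set w \<subseteq> index_set" and dist: "distinct (filter odd_index w)" using w by (auto simp: Tri_iff)
  have "matrices.assemble (orbit_sum odd_index w) = (\<Sum>u | mset u = mset w. ?m u)"
    by (simp add: orbit_sum_def matrices.assemble_sum) (simp add: matrices.assemble_def)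
  also have "\<dots> = (\<Sum>C\<in>stabilizer_cosets w. ?m (perm_list (?t C) w))"
    by (rule sum.reindex_bij_betw[OF bij_betw_stabilizer_cosets, symmetric])
  finally have "xi_rep A0 A1 w - matrices.assemble (orbit_sum odd_index w :: _ \<Rightarrow>\<^sub>0 'k) =
      (\<Sum>C\<in>stabilizer_cosets w. perm_word A0 A1 (length w) (?t C) (map unit_matrix w) -
        ?m (perm_list (?t C) w))"
    by (simp add: xi_rep_def unit_matrix_def sum_subtractf)
  also have "\<dots> \<in> tensor_ker (mat_scale smul)"
  proof (rule fmod.subspace_sum[OF subspace_tensor_ker])
    fix C assume C: "C \<in> stabilizer_cosets w"
    have \<sigma>: "?t C permutes {..<length w}"
      using some_mem_stabilizer_coset[OF C] .
    have "of_int (word_sign odd_index w (perm_list (?t C) w)) =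
        (- 1 :: 'k) ^ odd_inversions (?t C) (map odd_index w)"
      using word_sign_perm_list[OF \<sigma>, of odd_index w] word_sign_self[OF dist] by simp
    then show "perm_word A0 A1 (length w) (?t C) (map unit_matrix w) - ?m (perm_list (?t C) w)
        \<in> tensor_ker (mat_scale smul)"
      using perm_word_map_unit_matrix[OF \<sigma> set] by simp
  qed
  finally show ?thesis .
qed

section \<open>Tensors whose coproduct lies in the span of \<open>U\<close> tensor
  \<open>U\<close>\<close>

definition restrictable :: "(('a^'n::finite^'n) list \<Rightarrow>\<^sub>0 'k) set set \<Rightarrow> (('a^'n^'n) list \<Rightarrow>\<^sub>0 'k) set" where
  "restrictable U = {x. lin_ext deconcat x \<in> fmod.span (\<Union>{outer y z +o tensor2_ker (mat_scale smul) | y z.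
     y +o tensor_ker (mat_scale smul) \<in> U \<and> z +o tensor_ker (mat_scale smul) \<in> U})}"

lemma subspace_restrictable: "fmod.subspace (restrictable U)"
  by (auto simp: fmod.subspace_def restrictable_def lin_ext_add lin_ext_fscale
      intro: fmod.span_zero fmod.span_add fmod.span_scale)

lemma tensor_ker_restrictable:
  fixes x :: "('a^'n::finite^'n) list \<Rightarrow>\<^sub>0 'k"
  assumes "0 +o tensor_ker (mat_scale smul) \<in> U" "x \<in> tensor_ker (mat_scale smul)"
  shows "x \<in> restrictable U"
proof -
  let ?R = "tensor2_ker (mat_scale smul)"
  have "x +o tensor_ker (mat_scale smul) = 0 +o tensor_ker (mat_scale smul)"
    using assms(2) unfolding coset_eq_iff by simp
  \<comment> \<open>The coproduct is well defined on cosets, so the image of \<open>x\<close> lies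
    in the coset of 0, and 0 is the outer product of two representatives of the zero coset, which is
    in \<open>U\<close>.\<close>
  from arg_cong[OF this, of "coproduct (mat_scale smul)"]
  have "lin_ext deconcat x +o ?R = 0 +o ?R" unfolding coproduct_coset by simp
  moreover have "lin_ext deconcat x \<in> lin_ext deconcat x +o ?R"
    by (simp add: mem_coset_iff fmod.subspace_0[OF subspace_tensor2_ker])
  moreover have "outer 0 0 = (0 :: ('a^'n^'n) list \<times> ('a^'n^'n) list \<Rightarrow>\<^sub>0 'k)"
    by (rule poly_mapping_eqI) auto
  ultimately have "lin_ext deconcat x \<in> outer 0 0 +o ?R" by (simp only:)
  then show ?thesis
    using assms(1) unfolding restrictable_def by (blast intro: fmod.span_base)
qed

lemma coproduct_restricts:
  assumes "\<And>x. x \<in> \<Union>X \<Longrightarrow> x \<in> restrictable U"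
  shows "coproduct (mat_scale smul) ` quot_span (tensor_ker (mat_scale smul)) X \<subseteq>
    tensor_sub (mat_scale smul) U U"
proof -
  have "fmod.span (\<Union>X) \<subseteq> restrictable U"
    using assms by (intro fmod.span_minimal subspace_restrictable) auto
  then show ?thesis
    unfolding quot_span_def tensor_sub_def image_image coproduct_coset
    by (auto simp: restrictable_def)
qed

lemma invariants_mem_S_alg_deg:
  fixes y :: "('a \<times> 'n::finite \<times> 'n) list \<Rightarrow>\<^sub>0 'k"
  assumes y: "y \<in> weighted_invariants odd_index m index_set d"
  shows "matrices.assemble y +o tensor_ker (mat_scale smul) \<in> S_alg_deg smul A0 A1 d"
proof -
  have sym: "signed_symmetric odd_index y"
    and key: "\<And>w. w \<in> Poly_Mapping.keys y \<Longrightarrow> length w = d \<and> set w \<subseteq> index_set"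
    using y by (auto simp: weighted_invariants_def)
  have "length w = d" if "w \<in> Poly_Mapping.keys (matrices.assemble y)" for w
    using that key by (auto elim: matrices.keys_assemble)
  moreover have "perm_action smul A0 A1 d \<sigma> (matrices.assemble y +o tensor_ker (mat_scale smul)) =
      matrices.assemble y +o tensor_ker (mat_scale smul)" if \<sigma>: "\<sigma> permutes {..<d}" for \<sigma>
    using perm_word_assemble[OF \<sigma>, of y] signed_perm_eq[OF sym _ \<sigma>] key
    by (simp add: perm_action_coset[OF \<sigma>] coset_eq_iff)
  ultimately show ?thesis
    unfolding S_alg_deg_def tensor_power_def by blast
qed

text \<open>The expansion of \<open>y\<close> in weighted orbit sums involves only words in
  \<open>Tri\<close>, and for these the weighted orbit sum is the coordinate function of
  \<open>eta\<close>.\<close>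

lemma invariants_mem_T_alg_deg:
  fixes y :: "('a \<times> 'n::finite \<times> 'n) list \<Rightarrow>\<^sub>0 'k"
  assumes y: "y \<in> weighted_invariants odd_index (c_factorial Bc) index_set d"
  shows "matrices.assemble y +o tensor_ker (mat_scale smul) \<in> T_alg_deg smul A0 A1 Ba Bc B1 d"
proof -
  let ?V = "fmod.span (\<Union>(eta smul A0 A1 Bc ` (Tri A0 (Ba \<union> Bc \<union> B1) d :: ('a \<times> 'n \<times> 'n) list set)))
    :: (('a^'n^'n) list \<Rightarrow>\<^sub>0 'k) set"
  obtain R c where R: "finite R" "\<And>w. w \<in> R \<Longrightarrow> length w = d \<and> set w \<subseteq> index_set \<and> distinct (filter odd_index w)"
    and eq: "y = (\<Sum>w\<in>R. fscale (c w) (fscale (of_nat (c_factorial Bc w)) (orbit_sum odd_index w)))"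
    by (rule weighted_invariants_orbit_sums[OF y]) (rule that)
  have "matrices.assemble (fscale (of_nat (c_factorial Bc w)) (orbit_sum odd_index w)) \<in> ?V" if "w \<in> R" for w
  proof (rule fmod.span_base, rule UnionI)
    have "w \<in> Tri A0 (Ba \<union> Bc \<union> B1) d" using R(2)[OF that] by (simp add: Tri_iff)
    then show "eta smul A0 A1 Bc w \<in> eta smul A0 A1 Bc ` Tri A0 (Ba \<union> Bc \<union> B1) d" by (rule imageI)
    show "matrices.assemble (fscale (of_nat (c_factorial Bc w)) (orbit_sum odd_index w)) \<in> eta smul A0 A1 Bc w"
      using tensor_ker_sym[OF xi_rep_assemble[OF \<open>w \<in> Tri A0 (Ba \<union> Bc \<union> B1) d\<close>]]
      by (simp add: eta_def mem_coset_iff matrices.assemble_fscale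
          fmod.subspace_scale[OF subspace_tensor_ker] flip: fmod.scale_right_diff_distrib)
  qed
  then have "matrices.assemble y \<in> ?V"
    unfolding eq matrices.assemble_sum matrices.assemble_fscale[of "c _"]
    by (intro fmod.span_sum fmod.span_scale)
  then show ?thesis unfolding T_alg_deg_def quot_span_def by (rule imageI)
qed

end

section \<open>The coproduct over a domain of characteristic 0\<close>

locale good_pair_basis_domain = good_pair_basis smul A0 A1 \<aa> \<cc> Ba Bc B1
  for smul :: "'k::{idom, ring_char_0} \<Rightarrow> 'a::ring \<Rightarrow> 'a" and A0 A1 \<aa> \<cc> Ba Bc B1 :: "'a set"
begin

interpretation matrices: module_with_basis "mat_scale smul" index_set unit_matrix mat_coord
  by (rule module_with_basis_matrices)

lemma S_alg_deg_invariants: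
  fixes X :: "(('a^'n::finite^'n) list \<Rightarrow>\<^sub>0 'k) set"
  assumes "X \<in> S_alg_deg smul A0 A1 d"
  obtains y where "y \<in> weighted_invariants odd_index (\<lambda>_. 1) index_set d"
    "X = matrices.assemble y +o tensor_ker (mat_scale smul)"
proof -
  from assms obtain x where x: "X = x +o tensor_ker (mat_scale smul)"
    and len: "\<And>w. w \<in> Poly_Mapping.keys x \<Longrightarrow> length w = d"
    and inv: "\<And>\<sigma>. \<sigma> permutes {..<d} \<Longrightarrow> perm_action smul A0 A1 d \<sigma> X = X"
    by (auto simp: S_alg_deg_def tensor_power_def)
  define y where "y = matrices.expand x"
  have X: "X = matrices.assemble y +o tensor_ker (mat_scale smul)"
    using matrices.assemble_expand[of x] by (simp add: x y_def coset_eq_iff tensor_ker_sym)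
  have key: "length w = d \<and> set w \<subseteq> index_set" if "w \<in> Poly_Mapping.keys y" for w
    using that len unfolding y_def by (auto elim!: matrices.keys_expand)
  have fixed: "signed_perm odd_index \<sigma> y = y" if \<sigma>: "\<sigma> permutes {..<d}" for \<sigma>
  proof -
    have "lin_ext (perm_word A0 A1 d \<sigma>) (matrices.assemble y) - matrices.assemble y
        \<in> tensor_ker (mat_scale smul)"
      using inv[OF \<sigma>] by (simp add: X perm_action_coset[OF \<sigma>] coset_eq_iff)
    \<comment> \<open>Congruence becomes equality of coordinates: \<open>expand\<close> is constant
      on cosets and undoes \<open>assemble\<close> on words of basis indices.\<close>
    from tensor_ker_trans[OF tensor_ker_sym[OF perm_word_assemble[OF \<sigma> key]] this]
    have "matrices.expand (matrices.assemble (signed_perm odd_index \<sigma> y)) =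
        matrices.expand (matrices.assemble y)"
      by (rule matrices.expand_cong)
    moreover have "set w \<subseteq> index_set" if "w \<in> Poly_Mapping.keys (signed_perm odd_index \<sigma> y)" for w
    proof -
      from that obtain u where "u \<in> Poly_Mapping.keys y" "w = perm_list \<sigma> u" by (rule keys_signed_perm)
      with key[of u] \<sigma> show ?thesis by (simp add: perm_list_eq_permute_list)
    qed
    ultimately show ?thesis using key by (simp add: matrices.expand_assemble)
  qed
  have "signed_symmetric odd_index y"
  proof (rule signed_symmetricI)
    fix w :: "('a \<times> 'n \<times> 'n) list" and \<sigma> :: "nat \<Rightarrow> nat" assume \<sigma>: "\<sigma> permutes {..<length w}"
    show "Poly_Mapping.lookup y (perm_list \<sigma> w) =
      (- 1) ^ odd_inversions \<sigma> (map odd_index w) * Poly_Mapping.lookup y w"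
    proof (cases "length w = d")
      case True
      with lookup_signed_perm[of y d \<sigma> w odd_index] fixed[of \<sigma>] key \<sigma> show ?thesis by simp
    next
      case False
      then have "w \<notin> Poly_Mapping.keys y" "perm_list \<sigma> w \<notin> Poly_Mapping.keys y"
        using key[of w] key[of "perm_list \<sigma> w"] by (auto simp: perm_list_eq_permute_list)
      then show ?thesis by (simp add: in_keys_iff)
    qed
  qed
  with key have "y \<in> weighted_invariants odd_index (\<lambda>_. 1) index_set d"
    by (simp add: weighted_invariants_def)
  with X that show thesis by blast
qed

lemma assemble_invariants_restrictable:
  fixes y :: "('a \<times> 'n::finite \<times> 'n) list \<Rightarrow>\<^sub>0 'k" and m :: "('a \<times> 'n \<times> 'n) list \<Rightarrow> nat"
  assumes m: "\<And>w. m w \<noteq> 0" "\<And>u w. mset u = mset w \<Longrightarrow> m u = m w" "\<And>u v. m u * m v dvd m (u @ v)"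
    and U: "\<And>d z. z \<in> weighted_invariants odd_index m index_set d \<Longrightarrow>
      matrices.assemble z +o tensor_ker (mat_scale smul) \<in> U"
    and y: "y \<in> weighted_invariants odd_index m index_set d"
  shows "matrices.assemble y \<in> restrictable U"
proof -
  let ?W = "fmod.span (\<Union>{outer y z +o tensor2_ker (mat_scale smul) | y z.
     y +o tensor_ker (mat_scale smul) \<in> U \<and> z +o tensor_ker (mat_scale smul) \<in> U})"
  let ?g = "lin_ext (\<lambda>x. word (map unit_matrix (fst x), map unit_matrix (snd x)))
    :: (('a \<times> 'n \<times> 'n) list \<times> ('a \<times> 'n \<times> 'n) list \<Rightarrow>\<^sub>0 'k) \<Rightarrow> _"
  have outer_mem: "outer (matrices.assemble x) (matrices.assemble z) \<in> ?W"
    if "x \<in> weighted_invariants odd_index m index_set l" "z \<in> weighted_invariants odd_index m index_set l'"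
    for x z l l'
  proof (rule fmod.span_base, rule UnionI)
    show "outer (matrices.assemble x) (matrices.assemble z) +o tensor2_ker (mat_scale smul) \<in>
      {outer y z +o tensor2_ker (mat_scale smul) | y z.
        y +o tensor_ker (mat_scale smul) \<in> U \<and> z +o tensor_ker (mat_scale smul) \<in> U}"
      using U[OF that(1)] U[OF that(2)] by blast
  qed (simp add: mem_coset_iff fmod.subspace_0[OF subspace_tensor2_ker])
  have cut: "?g (lin_ext (\<lambda>w. word (take l w, drop l w)) y) \<in> ?W" if l: "l \<le> d" for l
  proof -
    obtain R f g where R: "finite (R :: ('a \<times> 'n \<times> 'n) list set)"
      "\<And>u. u \<in> R \<Longrightarrow> f u \<in> weighted_invariants odd_index m index_set l"
      "\<And>u. u \<in> R \<Longrightarrow> g u \<in> weighted_invariants odd_index m index_set (d - l)"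
      and eq: "lin_ext (\<lambda>w. word (take l w, drop l w)) y = (\<Sum>u\<in>R. outer (f u) (g u))"
      by (rule cut_weighted_invariants[OF m y l], assumption, rule that)
    have "?g (\<Sum>u\<in>R. outer (f u) (g u)) =
        (\<Sum>u\<in>R. outer (matrices.assemble (f u)) (matrices.assemble (g u)))"
      by (simp add: lin_ext_sum lin_ext_outer matrices.assemble_def)
    also have "\<dots> \<in> ?W" by (intro fmod.span_sum outer_mem[OF R(2) R(3)])
    finally show ?thesis by (simp add: eq)
  qed
  \<comment> \<open>Replacing letters by matrices commutes with cutting, and since all keys of
    \<open>y\<close> have length \<open>d\<close>, the cuts run over the same range
    \<open>l \<le> d\<close> for every word.\<close>
  have "lin_ext deconcat (matrices.assemble y) =
      lin_ext (\<lambda>w. \<Sum>l\<le>d. word (map unit_matrix (take l w), map unit_matrix (drop l w))) y"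
    unfolding matrices.assemble_def lin_ext_lin_ext
    by (rule lin_ext_cong)
       (use y in \<open>auto simp: deconcat_def take_map drop_map weighted_invariants_def\<close>)
  also have "\<dots> = (\<Sum>l\<le>d. ?g (lin_ext (\<lambda>w. word (take l w, drop l w)) y))"
    by (simp add: lin_ext_sum_fun lin_ext_lin_ext)
  also have "\<dots> \<in> ?W" by (intro fmod.span_sum cut) simp
  finally show ?thesis by (simp add: restrictable_def)
qed

text \<open>Passes from the representative \<open>matrices.assemble y\<close> to an arbitrary one.
  The zero coset lies in \<open>U\<close> because 0 is an invariant, so the whole kernel is
  restrictable.\<close>

lemma coset_restrictable:
  fixes y :: "('a \<times> 'n::finite \<times> 'n) list \<Rightarrow>\<^sub>0 'k" and m :: "('a \<times> 'n \<times> 'n) list \<Rightarrow> nat"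
  assumes m: "\<And>w. m w \<noteq> 0" "\<And>u w. mset u = mset w \<Longrightarrow> m u = m w" "\<And>u v. m u * m v dvd m (u @ v)"
    and U: "\<And>d z. z \<in> weighted_invariants odd_index m index_set d \<Longrightarrow>
      matrices.assemble z +o tensor_ker (mat_scale smul) \<in> U"
    and y: "y \<in> weighted_invariants odd_index m index_set d"
    and x: "x - matrices.assemble y \<in> tensor_ker (mat_scale smul)"
  shows "x \<in> restrictable U"
proof -
  have "0 \<in> weighted_invariants odd_index m index_set 0"
    by (simp add: weighted_invariants_def signed_symmetric_def)
  from U[OF this] have "0 +o tensor_ker (mat_scale smul) \<in> U" by (simp add: matrices.assemble_def)
  from fmod.subspace_add[OF subspace_restrictable tensor_ker_restrictable[OF this x]
      assemble_invariants_restrictable[OF m U y]]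
  show ?thesis by simp
qed

lemma coproduct_S_alg:
  "coproduct (mat_scale smul) ` (S_alg smul A0 A1 :: (('a^'n::finite^'n) list \<Rightarrow>\<^sub>0 'k) set set)
    \<subseteq> tensor_sub (mat_scale smul) (S_alg smul A0 A1) (S_alg smul A0 A1)"
proof -
  let ?U = "S_alg smul A0 A1 :: (('a^'n^'n) list \<Rightarrow>\<^sub>0 'k) set set"
  have U: "matrices.assemble z +o tensor_ker (mat_scale smul) \<in> ?U"
    if "z \<in> weighted_invariants odd_index (\<lambda>_. 1) index_set d" for d z
    using invariants_mem_S_alg_deg[OF that] unfolding S_alg_def
    by (intro quot_span_base fmod.subspace_0[OF subspace_tensor_ker]) blast
  have "x \<in> restrictable ?U" if "x \<in> \<Union>(\<Union>d. S_alg_deg smul A0 A1 d)" for x :: "('a^'n^'n) list \<Rightarrow>\<^sub>0 'k"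
  proof -
    from that obtain d X where "x \<in> X" "X \<in> S_alg_deg smul A0 A1 d" by blast
    then obtain y where "y \<in> weighted_invariants odd_index (\<lambda>_. 1) index_set d"
      "x - matrices.assemble y \<in> tensor_ker (mat_scale smul)"
      by (metis S_alg_deg_invariants mem_coset_iff)
    \<comment> \<open>The weight 1 imposes no divisibility, so only membership in \<open>?U\<close>
      has content.\<close>
    then show ?thesis by (rule coset_restrictable[of "\<lambda>_. 1", rotated 4]) (simp_all add: U)
  qed
  then show ?thesis unfolding S_alg_def[of smul A0 A1, where 'n = 'n]
    by (rule coproduct_restricts)
qed

lemma coproduct_T_alg:
  "coproduct (mat_scale smul) ` (T_alg smul A0 A1 Ba Bc B1 :: (('a^'n::finite^'n) list \<Rightarrow>\<^sub>0 'k) set set)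
    \<subseteq> tensor_sub (mat_scale smul) (T_alg smul A0 A1 Ba Bc B1) (T_alg smul A0 A1 Ba Bc B1)"
proof -
  let ?U = "T_alg smul A0 A1 Ba Bc B1 :: (('a^'n^'n) list \<Rightarrow>\<^sub>0 'k) set set"
  have U: "matrices.assemble z +o tensor_ker (mat_scale smul) \<in> ?U"
    if "z \<in> weighted_invariants odd_index (c_factorial Bc) index_set d" for d z
    using invariants_mem_T_alg_deg[OF that] unfolding T_alg_def
    by (intro quot_span_base fmod.subspace_0[OF subspace_tensor_ker]) blast
  have "0 \<in> weighted_invariants odd_index (c_factorial Bc) index_set 0"
    by (simp add: weighted_invariants_def signed_symmetric_def)
  from U[OF this] have zero: "0 +o tensor_ker (mat_scale smul) \<in> ?U" by (simp add: matrices.assemble_def)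
  have eta: "\<Union>(eta smul A0 A1 Bc ` Tri A0 (Ba \<union> Bc \<union> B1) d) \<subseteq> restrictable ?U" for d
  proof
    fix x :: "('a^'n^'n) list \<Rightarrow>\<^sub>0 'k"
    assume "x \<in> \<Union>(eta smul A0 A1 Bc ` Tri A0 (Ba \<union> Bc \<union> B1) d)"
    then obtain w :: "('a \<times> 'n \<times> 'n) list" where w: "w \<in> Tri A0 (Ba \<union> Bc \<union> B1) d"
      and x: "x \<in> eta smul A0 A1 Bc w" by blast
    let ?c = "of_nat (c_factorial Bc w) :: 'k"
    have "fscale ?c (xi_rep A0 A1 w) - matrices.assemble (fscale ?c (orbit_sum odd_index w))
        \<in> tensor_ker (mat_scale smul)"
      using xi_rep_assemble[OF w]
      by (simp add: matrices.assemble_fscale fmod.subspace_scale[OF subspace_tensor_ker]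
          flip: fmod.scale_right_diff_distrib)
    moreover have "x - fscale ?c (xi_rep A0 A1 w) \<in> tensor_ker (mat_scale smul)"
      using x by (simp add: eta_def mem_coset_iff)
    ultimately have diff: "x - matrices.assemble (fscale ?c (orbit_sum odd_index w))
        \<in> tensor_ker (mat_scale smul)"
      using tensor_ker_trans by blast
    have inv: "fscale ?c (orbit_sum odd_index w) \<in>
        weighted_invariants odd_index (c_factorial Bc) index_set d"
      using w by (intro orbit_sum_mem_weighted_invariants c_factorial_cong) (auto simp: Tri_iff)
    show "x \<in> restrictable ?U"
      by (rule coset_restrictable[of "c_factorial Bc", OF c_factorial_nonzero _ c_factorial_append U inv diff])
        (rule c_factorial_cong)
  qed
  \<comment> \<open>A representative of an element of \<open>T_alg_deg\<close> is a linear
    combination of representatives of the \<open>eta\<close> plus an element of the kernel, and both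
    summands are restrictable.\<close>
  have "x \<in> restrictable ?U" if "x \<in> \<Union>(\<Union>d. T_alg_deg smul A0 A1 Ba Bc B1 d)" for x
  proof -
    from that obtain d z where z: "z \<in> fmod.span (\<Union>(eta smul A0 A1 Bc ` Tri A0 (Ba \<union> Bc \<union> B1) d))"
      and x: "x - z \<in> tensor_ker (mat_scale smul)"
      by (auto simp: T_alg_deg_def quot_span_def mem_coset_iff)
    have "z \<in> restrictable ?U"
      using fmod.span_minimal[OF eta subspace_restrictable] z by blast
    from fmod.subspace_add[OF subspace_restrictable tensor_ker_restrictable[OF zero x] this]
    show ?thesis by simp
  qed
  then show ?thesis unfolding T_alg_def[of smul A0 A1 Ba Bc B1, where 'n = 'n]
    by (rule coproduct_restricts)
qed

end

theorem theorem3: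
  fixes smul :: "'k::{idom, ring_char_0} \<Rightarrow> 'a::ring \<Rightarrow> 'a"
    and A0 A1 \<aa> \<cc> Ba Bc B1 :: "'a set"
  assumes "unital_good_pair smul A0 A1 \<aa>"
    and "good_pair_basis smul A0 A1 \<aa> \<cc> Ba Bc B1"
  shows "coproduct (mat_scale smul) ` (S_alg smul A0 A1 :: (('a^'n::finite^'n) list \<Rightarrow>\<^sub>0 'k) set set)
           \<subseteq> tensor_sub (mat_scale smul) (S_alg smul A0 A1) (S_alg smul A0 A1)
       \<and> coproduct (mat_scale smul) ` (T_alg smul A0 A1 Ba Bc B1 :: (('a^'n^'n) list \<Rightarrow>\<^sub>0 'k) set set)
           \<subseteq> tensor_sub (mat_scale smul) (T_alg smul A0 A1 Ba Bc B1) (T_alg smul A0 A1 Ba Bc B1)"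
proof -
  interpret good_pair_basis_domain smul A0 A1 \<aa> \<cc> Ba Bc B1
    using assms(2) by (rule good_pair_basis_domain.intro)
  show ?thesis using coproduct_S_alg coproduct_T_alg by blast
qed

end
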